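(* For every finitely generated non-amenable group $G$, $\mathrm{epdim}(G)=1$.
   Context: For a group $G$, $\mathcal M(G)$ denotes the set of symmetric probability measures $\mu$ on $G$ ($\mu(g)=\mu(g^{-1})$). For $\mu\in\mathcal M(G)$ and $\lambda>0$, $G^\mu(\lambda)$ is the random multigraph with vertex set $G$ in which the number of parallel edges between distinct $g,h$ is an independent Poisson random variable with mean $\lambda\mu(g^{-1}h)$; $\lambda_c(\mu):=\sup\{\lambda : \Pr(G^\mu(\lambda)\text{ has an infinite component})=0\}$ (always $\lambda_c(\mu)\ge1$). Fix a finite generating set and let $|g|$ be the word length. For $r\in(0,1)$ and $s\in(0,1]$ let ${}_e\mathcal M_s^r(G):=\{\mu\in\mathcal M(G) : \mu(g)<r^{|g|^s}\ \forall g\in G\}$. The exponential percolation dimension is $\mathrm{epdim}(G):=\sup\{s : \exists r\in(0,1) \text{ such that } \inf_{\mu\in{}_e\mathcal M_s^r(G)}\lambda_c(\mu)=1\}$, i.e. the supremum of those $s$ for which, for some $r$, there is a sequence $\mu_i\in{}_e\mathcal M_s^r(G)$ with $\lambda_c(\mu_i)\to1$. It does not depend on the choice of generating set. *)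

theory Defs
  imports "HOL-Probability.Probability" "HOL-Algebra.Generated_Groups"
begin

definition amenable :: "('a, 'b) monoid_scheme \<Rightarrow> bool" where
  "amenable G \<longleftrightarrow> (\<exists>m :: 'a set \<Rightarrow> real.
      (\<forall>A. A \<subseteq> carrier G \<longrightarrow> m A \<ge> 0)
    \<and> m (carrier G) = 1
    \<and> (\<forall>A B. A \<subseteq> carrier G \<longrightarrow> B \<subseteq> carrier G \<longrightarrow> A \<inter> B = {} \<longrightarrow> m (A \<union> B) = m A + m B)
    \<and> (\<forall>g A. g \<in> carrier G \<longrightarrow> A \<subseteq> carrier G \<longrightarrow> m ((\<lambda>x. g \<otimes>\<^bsub>G\<^esub> x) ` A) = m A))"

definition word_length :: "('a, 'b) monoid_scheme \<Rightarrow> 'a set \<Rightarrow> 'a \<Rightarrow> nat" where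
  "word_length G S g = (LEAST n. \<exists>xs. length xs = n \<and> set xs \<subseteq> S \<union> m_inv G ` S
                                   \<and> foldr (\<lambda>x y. x \<otimes>\<^bsub>G\<^esub> y) xs \<one>\<^bsub>G\<^esub> = g)"

definition sym_prob :: "('a, 'b) monoid_scheme \<Rightarrow> ('a \<Rightarrow> real) \<Rightarrow> bool" where
  "sym_prob G \<mu> \<longleftrightarrow> (\<forall>g\<in>carrier G. \<mu> g \<ge> 0 \<and> \<mu> g = \<mu> (inv\<^bsub>G\<^esub> g)) \<and> (\<mu> has_sum 1) (carrier G)"

definition poisson :: "real \<Rightarrow> nat pmf" where
  "poisson m = (if m > 0 then poisson_pmf m else return_pmf 0)"

definition pairs :: "('a, 'b) monoid_scheme \<Rightarrow> 'a set set" where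
  "pairs G = {{g, h} | g h. g \<in> carrier G \<and> h \<in> carrier G \<and> g \<noteq> h}"

text \<open>For e = {g,h}: \<mu>(g^-1 h) (well defined for symmetric \<mu>).\<close>
definition pair_weight :: "('a, 'b) monoid_scheme \<Rightarrow> ('a \<Rightarrow> real) \<Rightarrow> 'a set \<Rightarrow> real" where
  "pair_weight G \<mu> e = (let g = (SOME g. g \<in> e); h = (SOME h. h \<in> e \<and> h \<noteq> g)
                         in \<mu> (inv\<^bsub>G\<^esub> g \<otimes>\<^bsub>G\<^esub> h))"

definition multigraph_law :: "('a, 'b) monoid_scheme \<Rightarrow> ('a \<Rightarrow> real) \<Rightarrow> real \<Rightarrow> ('a set \<Rightarrow> nat) measure" where
  "multigraph_law G \<mu> lam = (\<Pi>\<^sub>M e\<in>pairs G. measure_pmf (poisson (lam * pair_weight G \<mu> e)))"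

definition adjacent :: "('a, 'b) monoid_scheme \<Rightarrow> ('a set \<Rightarrow> nat) \<Rightarrow> ('a \<times> 'a) set" where
  "adjacent G \<omega> = {(g, h). g \<in> carrier G \<and> h \<in> carrier G \<and> g \<noteq> h \<and> \<omega> {g, h} > 0}"

definition has_infinite_component :: "('a, 'b) monoid_scheme \<Rightarrow> ('a set \<Rightarrow> nat) \<Rightarrow> bool" where
  "has_infinite_component G \<omega> \<longleftrightarrow> (\<exists>g\<in>carrier G. infinite {h. (g, h) \<in> (adjacent G \<omega>)\<^sup>*})"

definition prob_infinite_component :: "('a, 'b) monoid_scheme \<Rightarrow> ('a \<Rightarrow> real) \<Rightarrow> real \<Rightarrow> real" where
  "prob_infinite_component G \<mu> lam =
     measure (multigraph_law G \<mu> lam)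
       {\<omega> \<in> space (multigraph_law G \<mu> lam). has_infinite_component G \<omega>}"

definition lambda_c :: "('a, 'b) monoid_scheme \<Rightarrow> ('a \<Rightarrow> real) \<Rightarrow> ereal" where
  "lambda_c G \<mu> = Sup {ereal lam | lam. lam > 0 \<and> prob_infinite_component G \<mu> lam = 0}"

definition exp_class :: "('a, 'b) monoid_scheme \<Rightarrow> 'a set \<Rightarrow> real \<Rightarrow> real \<Rightarrow> ('a \<Rightarrow> real) set" where
  "exp_class G S r s = {\<mu>. sym_prob G \<mu> \<and>
      (\<forall>g\<in>carrier G. \<mu> g < r powr (real (word_length G S g) powr s))}"

definition epdim :: "('a, 'b) monoid_scheme \<Rightarrow> 'a set \<Rightarrow> ereal" where
  "epdim G S = Sup {ereal s | s. 0 < s \<and> s \<le> 1 \<and>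
      (\<exists>r. 0 < r \<and> r < 1 \<and> (INF \<mu>\<in>exp_class G S r s. lambda_c G \<mu>) = 1)}"

end

(*
  Let P be convolution with the uniform measure on T = {1} \<union> S \<union> S^-1, and let \<mu>_n be the law of
  the n-th step of this lazy random walk. Non-amenability gives the expansion property (otherwise a
  limit of the normalised counting measures of almost invariant sets is an invariant mean), hence
  by Cheeger's argument a spectral gap: P contracts l^2 by some \<rho> < 1. Therefore \<mu>_n(g) \<le> \<rho>^n, and
  \<mu>_n is supported on the ball of radius n, so that \<mu>_n(g) \<le> \<rho>^|g|. Moreover a finite set K has
  internal \<mu>_n-weight at most \<rho>^n |K|, that is, boundary weight at least (1 - \<rho>^n) |K|.

  Such an isoperimetric bound forces \<lambda>_c \<le> 1 / (1 - \<rho>^n): passing from intensity \<lambda> to \<theta> \<lambda> multiplies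
  the probability that a finite set K is the cluster of the identity by at least
  \<theta>^(|K| - 1) exp ((1 - \<theta>) \<lambda> (1 - \<rho>^n) |K|), the first factor being the cost of keeping a spanning
  tree and the second the gain on the boundary. If a = \<lambda> (1 - \<rho>^n) > 1, then for \<theta> = 1 / a this is at
  least 1 / \<theta>; summing over K, the cluster is finite at intensity \<lambda> with probability at most \<theta> < 1.
  The opposite bound \<lambda>_c \<ge> 1 is a first moment estimate over self-avoiding paths.
*)

theory Submission
  imports Defs
begin

section \<open>Expansion of non-amenable groups\<close>

text \<open>The number \<open>\<rho>\<close> does not depend on n. Hence a single \<open>r\<close>
  slightly above \<open>\<rho>\<close> serves the whole sequence \<open>\<mu> n\<close>, while the
  bounds \<open>1 / (1 - \<rho> ^ n)\<close> tend to 1; this is why the exponent s = 1 itself is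
  attained. Sides matter. Amenability speaks of left translations, and the edge weights \<mu>(g^-1
  h) are left invariant, so the walk must take its steps on the right: averaging then commutes with
  left translations, and the expansion has to be carried over by inversion. The identity in T
  anchors a variance inequality: it compares each value f(x) with the values f(x t) that are
  averaged at x. A lower bound on the energy of f thereby becomes a contraction of the l^2 norm in
  one step. In the percolation part, the finite support of \<mu> makes the event that a finite set K
  is the cluster depend, up to a null set, on finitely many edges. Its probability is then a finite
  sum of products, and two intensities can be compared by induction on the edges inside K.\<close>

lemma card_Diff_eq_of_card_eq:
  assumes "finite A" "finite B" "card A = card B"
  shows "card (A - B) = card (B - A)"
  using card_Diff_subset_Int[of A B] card_Diff_subset_Int[of B A] assms
  by (simp add: Int_commute)

context group
begin

lemma inj_on_left_mult: "g \<in> carrier G \<Longrightarrow> A \<subseteq> carrier G \<Longrightarrow> inj_on (\<lambda>x. g \<otimes> x) A"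
  by (auto simp: inj_on_def subset_iff)

lemma left_mult_invariant_generate:
  fixes m :: "'a set \<Rightarrow> real"
  assumes S: "S \<subseteq> carrier G" and g: "g \<in> generate G S"
    and inv: "\<And>s A. s \<in> S \<Longrightarrow> A \<subseteq> carrier G \<Longrightarrow> m ((\<lambda>x. s \<otimes> x) ` A) = m A"
    and A: "A \<subseteq> carrier G"
  shows "m ((\<lambda>x. g \<otimes> x) ` A) = m A"
  using g A
proof (induction arbitrary: A rule: generate.induct)
  case one
  then have "(\<lambda>x. \<one> \<otimes> x) ` A = A" by (force simp: subset_iff)
  then show ?case by simp
next
  case (incl h)
  then show ?case using inv by blast
next
  case (inv h)
  let ?B = "(\<lambda>x. inv h \<otimes> x) ` A"
  have h: "h \<in> carrier G" using inv S by auto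
  have "(\<lambda>x. h \<otimes> x) ` ?B = (\<lambda>x. x) ` A"
    unfolding image_image by (rule image_cong) (use h inv in \<open>auto simp: m_assoc[symmetric]\<close>)
  moreover have "?B \<subseteq> carrier G" using h inv by auto
  ultimately show ?case using assms(3)[OF inv(1), of ?B] by simp
next
  case (eng h1 h2)
  have h: "h1 \<in> carrier G" "h2 \<in> carrier G"
    using eng generate_in_carrier[OF S] by auto
  have "(\<lambda>x. h1 \<otimes> h2 \<otimes> x) ` A = (\<lambda>x. h1 \<otimes> x) ` ((\<lambda>x. h2 \<otimes> x) ` A)"
    unfolding image_image by (rule image_cong) (use h eng in \<open>auto simp: m_assoc\<close>)
  moreover have "(\<lambda>x. h2 \<otimes> x) ` A \<subseteq> carrier G" using h eng by auto
  ultimately show ?case using eng by simp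
qed

text \<open>Translation preserves cardinality, so \<open>A \<inter> K\<close> can be replaced by
  \<open>sA \<inter> sK\<close>, which differs from \<open>sA \<inter> K\<close> only on the
  symmetric difference of \<open>K\<close> and \<open>sK\<close>. The two halves of that difference
  have equal size because \<open>K\<close> and \<open>sK\<close> do, so one of them bounds the error
  in both directions.\<close>

lemma card_translate_Int_diff_le:
  assumes s: "s \<in> carrier G" and K: "finite K" "K \<subseteq> carrier G" and A: "A \<subseteq> carrier G"
  shows "\<bar>real (card ((\<lambda>x. s \<otimes> x) ` A \<inter> K)) - real (card (A \<inter> K))\<bar>
           \<le> real (card ((\<lambda>x. s \<otimes> x) ` K - K))"
proof -
  let ?sA = "(\<lambda>x. s \<otimes> x) ` A" and ?sK = "(\<lambda>x. s \<otimes> x) ` K"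
  have "card ?sK = card K" using inj_on_left_mult[OF s K(2)] by (rule card_image)
  then have sym: "card (K - ?sK) = card (?sK - K)"
    using K by (intro card_Diff_eq_of_card_eq) auto
  have "?sA \<inter> ?sK = (\<lambda>x. s \<otimes> x) ` (A \<inter> K)"
    using inj_on_left_mult[OF s, of "carrier G"] A K by (subst inj_on_image_Int) auto
  then have AK: "card (A \<inter> K) = card (?sA \<inter> ?sK)"
    using inj_on_left_mult[OF s, of "A \<inter> K"] A by (simp add: card_image le_infI1)
  have "card (?sA \<inter> ?sK) \<le> card ((?sA \<inter> K) \<union> (?sK - K))"
    using K by (intro card_mono) auto
  also have "\<dots> \<le> card (?sA \<inter> K) + card (?sK - K)" by (rule card_Un_le)
  finally have 1: "card (A \<inter> K) \<le> card (?sA \<inter> K) + card (?sK - K)" using AK by simp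
  have "card (?sA \<inter> K) \<le> card ((?sA \<inter> ?sK) \<union> (K - ?sK))"
    using K by (intro card_mono) auto
  also have "\<dots> \<le> card (?sA \<inter> ?sK) + card (K - ?sK)" by (rule card_Un_le)
  finally show ?thesis using 1 AK sym by linarith
qed

text \<open>Compactness replaces a limit of the densities \<open>d N\<close>. The cube
  \<open>X\<close> is compact in the topology of pointwise convergence, and \<open>F n\<close> is a
  closed set of normalised additive set functions that are invariant up to 1/(n+1). Since
  \<open>d N\<close> lies in \<open>F n\<close> for all \<open>N \<ge> n\<close>, finitely many of
  these sets always meet inside \<open>X\<close>. A common point of all of them is exactly invariant
  under \<open>S\<close>, hence under the group that \<open>S\<close> generates.\<close>

lemma almost_invariant_imp_amenable:
  assumes S: "S \<subseteq> carrier G" "generate G S = carrier G"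
    and K: "\<And>n. finite (K n)" "\<And>n. K n \<subseteq> carrier G" "\<And>n. K n \<noteq> {}"
    and small: "\<And>n s. s \<in> S \<Longrightarrow>
       real (card ((\<lambda>x. s \<otimes> x) ` K n - K n)) \<le> real (card (K n)) / real (Suc n)"
  shows "amenable G"
proof -
  define d where "d n A = real (card (A \<inter> K n)) / real (card (K n))" for n A
  have Kpos: "real (card (K n)) > 0" for n using K by (simp add: card_gt_0_iff)
  define X :: "('a set \<Rightarrow> real) set" where "X = PiE UNIV (\<lambda>_. {0..1})"
  define F where "F n = {m. m (carrier G) = 1}
     \<inter> (\<Inter>(A, B)\<in>{(A, B). A \<subseteq> carrier G \<and> B \<subseteq> carrier G \<and> A \<inter> B = {}}. {m. m (A \<union> B) = m A + m B})
     \<inter> (\<Inter>(s, A)\<in>S \<times> Pow (carrier G).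
          {m :: 'a set \<Rightarrow> real. \<bar>m ((\<lambda>x. s \<otimes> x) ` A) - m A\<bar> \<le> 1 / real (Suc n)})" for n
  have X: "compact X"
    unfolding X_def
    by (subst compactin_euclidean_iff[symmetric], subst euclidean_product_topology[symmetric],
        subst compactin_PiE) auto
  have cont: "continuous_on UNIV (\<lambda>m :: 'a set \<Rightarrow> real. m A)" for A
    by (rule continuous_on_product_coordinates)
  have F: "closed (F n)" for n
    unfolding F_def
    by (intro closed_Int closed_INT ballI)
       (auto intro!: closed_Collect_eq closed_Collect_le continuous_intros cont)
  have dF: "d N \<in> F n" if "n \<le> N" for n N
  proof -
    have "d N (carrier G) = 1"
      using K(2)[of N] Kpos[of N] by (simp add: d_def Int_absorb1)
    moreover have "d N (A \<union> B) = d N A + d N B" if "A \<inter> B = {}" for A B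
    proof -
      have "card ((A \<union> B) \<inter> K N) = card (A \<inter> K N) + card (B \<inter> K N)"
        unfolding Int_Un_distrib2 using K that by (intro card_Un_disjoint) auto
      then show ?thesis by (simp add: d_def add_divide_distrib)
    qed
    moreover have "\<bar>d N ((\<lambda>x. s \<otimes> x) ` A) - d N A\<bar> \<le> 1 / real (Suc n)"
      if "s \<in> S" "A \<subseteq> carrier G" for s A
    proof -
      have "\<bar>d N ((\<lambda>x. s \<otimes> x) ` A) - d N A\<bar> =
          \<bar>real (card ((\<lambda>x. s \<otimes> x) ` A \<inter> K N)) - real (card (A \<inter> K N))\<bar> / real (card (K N))"
        using Kpos[of N] by (simp add: d_def diff_divide_distrib[symmetric] abs_divide)
      also have "\<dots> \<le> (real (card (K N)) / real (Suc N)) / real (card (K N))"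
        by (intro divide_right_mono order_trans[OF card_translate_Int_diff_le small] K)
           (use that S in auto)
      also have "\<dots> = 1 / real (Suc N)" using Kpos[of N] by simp
      also have "\<dots> \<le> 1 / real (Suc n)" using \<open>n \<le> N\<close> by (simp add: frac_le)
      finally show ?thesis .
    qed
    ultimately show ?thesis unfolding F_def by auto
  qed
  have dX: "d N \<in> X" for N
    using K Kpos[of N] by (auto simp: X_def d_def intro!: card_mono)
  have "X \<inter> (\<Inter>n\<in>UNIV. F n) \<noteq> {}"
  proof (rule compact_imp_fip_image[OF X])
    fix I' :: "nat set" assume "finite I'"
    then obtain N where "\<forall>n\<in>I'. n \<le> N" using finite_nat_set_iff_bounded_le by auto
    then have "d N \<in> X \<inter> (\<Inter>n\<in>I'. F n)" using dF dX by auto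
    then show "X \<inter> (\<Inter>n\<in>I'. F n) \<noteq> {}" by blast
  qed (use F in auto)
  then obtain m where m: "m \<in> X" "\<And>n. m \<in> F n" by auto
  have inv: "m ((\<lambda>x. s \<otimes> x) ` A) = m A" if "s \<in> S" "A \<subseteq> carrier G" for s A
  proof -
    have le: "\<bar>m ((\<lambda>x. s \<otimes> x) ` A) - m A\<bar> \<le> 1 / real (Suc n)" for n
      using m(2)[of n] that unfolding F_def by auto
    have "\<not> 0 < \<bar>m ((\<lambda>x. s \<otimes> x) ` A) - m A\<bar>"
    proof
      assume "0 < \<bar>m ((\<lambda>x. s \<otimes> x) ` A) - m A\<bar>"
      from nat_approx_posE[OF this] obtain n
        where "1 / real (Suc n) < \<bar>m ((\<lambda>x. s \<otimes> x) ` A) - m A\<bar>" by blast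
      with le[of n] show False by linarith
    qed
    then show ?thesis by simp
  qed
  show ?thesis
    unfolding amenable_def
  proof (intro exI[of _ m] conjI allI impI)
    show "m A \<ge> 0" for A using m(1) by (auto simp: X_def PiE_iff)
    show "m (carrier G) = 1" using m(2)[of 0] by (simp add: F_def)
    show "m (A \<union> B) = m A + m B"
      if "A \<subseteq> carrier G" "B \<subseteq> carrier G" "A \<inter> B = {}" for A B
      using m(2)[of 0] that by (auto simp: F_def)
    show "m ((\<lambda>x. g \<otimes> x) ` A) = m A" if "g \<in> carrier G" "A \<subseteq> carrier G" for g A
      using left_mult_invariant_generate[of S g m A] S inv that by auto
  qed
qed

lemma nonamenable_expansion:
  assumes "S \<subseteq> carrier G" "generate G S = carrier G" "\<not> amenable G"
  obtains \<epsilon> where "\<epsilon> > 0"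
    "\<And>K. finite K \<Longrightarrow> K \<subseteq> carrier G \<Longrightarrow> K \<noteq> {} \<Longrightarrow>
       \<exists>s\<in>S. \<epsilon> * real (card K) \<le> real (card ((\<lambda>x. s \<otimes> x) ` K - K))"
proof -
  define small where "small n K \<longleftrightarrow> finite K \<and> K \<subseteq> carrier G \<and> K \<noteq> {} \<and>
     (\<forall>s\<in>S. real (card ((\<lambda>x. s \<otimes> x) ` K - K)) \<le> real (card K) / real (Suc n))" for n K
  have "\<not> (\<forall>n. \<exists>K. small n K)"
  proof
    assume "\<forall>n. \<exists>K. small n K"
    from choice[OF this] obtain K where "\<forall>n. small n (K n)" ..
    then have "amenable G"
      by (intro almost_invariant_imp_amenable[of S K] assms) (auto simp: small_def)
    with assms show False by simp
  qed
  then obtain n where n: "\<And>K. \<not> small n K" by blast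
  show thesis
  proof (rule that[of "1 / real (Suc n)"])
    fix K assume K: "finite K" "K \<subseteq> carrier G" "K \<noteq> {}"
    then obtain s where "s \<in> S"
        "\<not> real (card ((\<lambda>x. s \<otimes> x) ` K - K)) \<le> real (card K) / real (Suc n)"
      using n[of K] unfolding small_def by blast
    then show "\<exists>s\<in>S. 1 / real (Suc n) * real (card K) \<le> real (card ((\<lambda>x. s \<otimes> x) ` K - K))"
      by (intro bexI[of _ s]) auto
  qed simp
qed

end

section \<open>Spectral gap\<close>

text \<open>With \<open>a t = a s + d t\<close>, the difference of \<open>card T\<close> times the
  sum of squares and the square of the sum is the same expression in \<open>d\<close>. Since
  \<open>d s = 0\<close>, Cauchy-Schwarz on \<open>T - {s}\<close> costs only
  \<open>card T - 1\<close>, and the unit saved is the sum of squared deviations from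
  \<open>a s\<close>.\<close>

lemma square_sum_add_deviation_le:
  fixes a :: "'c \<Rightarrow> real"
  assumes T: "finite T" "s \<in> T"
  shows "(\<Sum>t\<in>T. a t)\<^sup>2 + (\<Sum>t\<in>T. (a s - a t)\<^sup>2) \<le> real (card T) * (\<Sum>t\<in>T. (a t)\<^sup>2)"
proof -
  define d where "d t = a t - a s" for t
  let ?n = "real (card T)"
  have n: "real (card (T - {s})) = ?n - 1" using T card_gt_0_iff[of T] by (auto simp: of_nat_diff)
  have D: "sum d T = sum d (T - {s})" "(\<Sum>t\<in>T. (d t)\<^sup>2) = (\<Sum>t\<in>T-{s}. (d t)\<^sup>2)"
    using T by (simp_all add: sum.remove d_def)
  have "(sum d T)\<^sup>2 \<le> (?n - 1) * (\<Sum>t\<in>T. (d t)\<^sup>2)"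
    using sum_squared_le_sum_of_squares[of d "T - {s}"] unfolding D n by (simp add: mult.commute)
  moreover have "sum a T = sum d T + ?n * a s"
    by (simp add: d_def sum_subtractf)
  moreover have "(\<Sum>t\<in>T. (a t)\<^sup>2) = (\<Sum>t\<in>T. (d t)\<^sup>2) + 2 * a s * sum d T + ?n * (a s)\<^sup>2"
  proof -
    have sq: "(a t)\<^sup>2 = (d t)\<^sup>2 + 2 * a s * d t + (a s)\<^sup>2" for t
      by (simp add: d_def power2_eq_square algebra_simps)
    have "(\<Sum>t\<in>T. (a t)\<^sup>2) = (\<Sum>t\<in>T. (d t)\<^sup>2 + 2 * a s * d t + (a s)\<^sup>2)"
      by (intro sum.cong refl sq)
    also have "\<dots> = (\<Sum>t\<in>T. (d t)\<^sup>2) + 2 * a s * sum d T + ?n * (a s)\<^sup>2"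
      unfolding sum.distrib by (simp add: sum_distrib_left)
    finally show ?thesis .
  qed
  moreover have "(\<Sum>t\<in>T. (a s - a t)\<^sup>2) = (\<Sum>t\<in>T. (d t)\<^sup>2)"
    by (simp add: d_def power2_commute)
  ultimately show ?thesis by (simp add: power2_eq_square algebra_simps)
qed

context group
begin

section \<open>Finitely supported functions, isoperimetry and the averaging operator\<close>

definition fsupp :: "('a \<Rightarrow> real) \<Rightarrow> bool" where
  "fsupp f \<longleftrightarrow> finite {x \<in> carrier G. f x \<noteq> 0}"

lemma fsupp_summable [simp]: "fsupp f \<Longrightarrow> f summable_on carrier G"
  unfolding fsupp_def by (rule finite_nonzero_values_imp_summable_on)

lemma fsupp_translate:
  assumes f: "fsupp f" and t: "t \<in> carrier G"
  shows "fsupp (\<lambda>x. f (x \<otimes> t))"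
proof -
  have "{x \<in> carrier G. f (x \<otimes> t) \<noteq> 0} \<subseteq> (\<lambda>y. y \<otimes> inv t) ` {x \<in> carrier G. f x \<noteq> 0}"
  proof
    fix x assume x: "x \<in> {x \<in> carrier G. f (x \<otimes> t) \<noteq> 0}"
    then show "x \<in> (\<lambda>y. y \<otimes> inv t) ` {x \<in> carrier G. f x \<noteq> 0}"
      using t by (intro image_eqI[of _ _ "x \<otimes> t"]) (auto simp: m_assoc)
  qed
  then show ?thesis using f unfolding fsupp_def by (rule finite_subset[OF _ finite_imageI])
qed

lemma fsupp_left_translate:
  assumes f: "fsupp f" and t: "t \<in> carrier G"
  shows "fsupp (\<lambda>x. f (t \<otimes> x))"
proof -
  have "{x \<in> carrier G. f (t \<otimes> x) \<noteq> 0} \<subseteq> (\<lambda>y. inv t \<otimes> y) ` {x \<in> carrier G. f x \<noteq> 0}"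
  proof
    fix x assume x: "x \<in> {x \<in> carrier G. f (t \<otimes> x) \<noteq> 0}"
    then show "x \<in> (\<lambda>y. inv t \<otimes> y) ` {x \<in> carrier G. f x \<noteq> 0}"
      using t by (intro image_eqI[of _ _ "t \<otimes> x"]) (auto simp: m_assoc[symmetric])
  qed
  then show ?thesis using f unfolding fsupp_def by (rule finite_subset[OF _ finite_imageI])
qed

lemma fsupp_combine2:
  assumes "fsupp f" "fsupp g" "\<And>x. x \<in> carrier G \<Longrightarrow> f x = 0 \<Longrightarrow> g x = 0 \<Longrightarrow> h x = 0"
  shows "fsupp h"
proof -
  have "{x \<in> carrier G. h x \<noteq> 0} \<subseteq> {x \<in> carrier G. f x \<noteq> 0} \<union> {x \<in> carrier G. g x \<noteq> 0}"
    using assms(3) by auto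
  then show ?thesis using assms(1,2) unfolding fsupp_def by (rule finite_subset[OF _ finite_UnI])
qed

lemma fsupp_combine:
  assumes "fsupp f" "\<And>x. x \<in> carrier G \<Longrightarrow> f x = 0 \<Longrightarrow> h x = 0"
  shows "fsupp h"
  using fsupp_combine2[OF assms(1,1)] assms(2) by blast

lemma fsupp_sum:
  assumes "finite T" "\<And>t. t \<in> T \<Longrightarrow> fsupp (f t)"
  shows "fsupp (\<lambda>x. \<Sum>t\<in>T. f t x)"
  using assms
proof (induction T rule: finite_induct)
  case empty
  then show ?case by (simp add: fsupp_def)
next
  case (insert t T)
  then show ?case by (auto intro: fsupp_combine2[of "f t" "\<lambda>x. \<Sum>t\<in>T. f t x"])
qed

lemma fsupp_indicator: "finite K \<Longrightarrow> fsupp (indicator K)"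
  unfolding fsupp_def by (rule finite_subset[of _ K]) (auto simp: indicator_def)

lemma bij_betw_right_mult: "t \<in> carrier G \<Longrightarrow> bij_betw (\<lambda>x. x \<otimes> t) (carrier G) (carrier G)"
  by (rule bij_betw_byWitness[of _ "\<lambda>x. x \<otimes> inv t"]) (auto simp: m_assoc)

lemma infsum_translate:
  "t \<in> carrier G \<Longrightarrow> (\<Sum>\<^sub>\<infinity>x\<in>carrier G. f (x \<otimes> t)) = (\<Sum>\<^sub>\<infinity>x\<in>carrier G. f x :: real)"
  using infsum_reindex_bij_betw[OF bij_betw_right_mult, of t f] .

lemma infsum_sum_fsupp:
  assumes "finite T" "\<And>t. t \<in> T \<Longrightarrow> fsupp (f t)"
  shows "(\<Sum>\<^sub>\<infinity>x\<in>carrier G. \<Sum>t\<in>T. f t x) = (\<Sum>t\<in>T. \<Sum>\<^sub>\<infinity>x\<in>carrier G. f t x)"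
  using assms
proof (induction T rule: finite_induct)
  case (insert t T)
  then show ?case by (simp add: infsum_add fsupp_sum)
qed simp

lemma infsum_indicator_finite:
  assumes "finite K" "K \<subseteq> carrier G"
  shows "(\<Sum>\<^sub>\<infinity>x\<in>carrier G. indicator K x) = real (card K)"
proof -
  have "(\<Sum>\<^sub>\<infinity>x\<in>carrier G. indicator K x :: real) = (\<Sum>\<^sub>\<infinity>x\<in>K. 1)"
    using assms by (intro infsum_cong_neutral) auto
  then show ?thesis using assms by simp
qed

text \<open>A discrete coarea argument: peeling off the lowest level of \<open>u\<close> reduces the claim to
  indicator functions, where it is the expansion hypothesis.\<close>

lemma expansion_imp_l1_isoperimetry:
  fixes u :: "'a \<Rightarrow> real"
  assumes T: "finite T" "T \<subseteq> carrier G"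
    and ex: "\<And>K. finite K \<Longrightarrow> K \<subseteq> carrier G \<Longrightarrow> K \<noteq> {} \<Longrightarrow>
               \<exists>t\<in>T. \<epsilon> * real (card K) \<le> real (card {x \<in> K. x \<otimes> t \<notin> K})"
    and u: "fsupp u" "\<And>x. x \<in> carrier G \<Longrightarrow> u x \<ge> 0"
  shows "\<epsilon> * (\<Sum>\<^sub>\<infinity>x\<in>carrier G. u x) \<le> (\<Sum>t\<in>T. \<Sum>\<^sub>\<infinity>x\<in>carrier G. \<bar>u x - u (x \<otimes> t)\<bar>)"
  using u
proof (induction "card {x \<in> carrier G. u x \<noteq> 0}" arbitrary: u rule: less_induct)
  case less
  define K where "K = {x \<in> carrier G. u x \<noteq> 0}"
  have K: "finite K" "K \<subseteq> carrier G" using less.prems by (auto simp: K_def fsupp_def)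
  show ?case
  proof (cases "K = {}")
    case True
    then have "(\<Sum>\<^sub>\<infinity>x\<in>carrier G. u x) = 0" by (intro infsum_0) (auto simp: K_def)
    then show ?thesis by (auto intro!: sum_nonneg infsum_nonneg)
  next
    case False
    define m where "m = Min (u ` K)"
    define v where "v x = u x - m * indicator K x" for x
    have m_in: "m \<in> u ` K" unfolding m_def using K False by (intro Min_in) auto
    have m_le: "m \<le> u x" if "x \<in> K" for x unfolding m_def using K that by auto
    have m_pos: "m > 0" using m_in less.prems(2) by (force simp: K_def)
    have v0: "v x = 0" if "x \<in> carrier G" "x \<notin> K" for x
      using that by (simp add: v_def K_def)
    have v_nonneg: "v x \<ge> 0" if "x \<in> carrier G" for x
      using m_le[of x] v0[OF that] by (cases "x \<in> K") (auto simp: v_def)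
    obtain y where y: "y \<in> K" "v y = 0" using m_in by (auto simp: v_def)
    have "{x \<in> carrier G. v x \<noteq> 0} \<subset> K" using v0 y by blast
    then have card_less: "card {x \<in> carrier G. v x \<noteq> 0} < card {x \<in> carrier G. u x \<noteq> 0}"
      using psubset_card_mono[OF K(1)] by (simp add: K_def)
    have sI: "fsupp (\<lambda>x. indicator K x)" using fsupp_indicator[OF K(1)] .
    have sv: "fsupp v"
      using less.prems(1) sI by (rule fsupp_combine2) (auto simp: v_def)
    note IH = less.hyps[OF card_less sv v_nonneg]
    \<comment> \<open>No cancellation occurs: \<open>v\<close> is nonnegative and vanishes off
      \<open>K\<close>, so whenever the indicator changes between \<open>x\<close> and
      \<open>x \<otimes> t\<close>, the function \<open>v\<close> changes in the same direction or
      not at all.\<close>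
    have split: "\<bar>u x - u (x \<otimes> t)\<bar> =
        \<bar>v x - v (x \<otimes> t)\<bar> + m * \<bar>indicator K x - indicator K (x \<otimes> t)\<bar>"
      if "x \<in> carrier G" "t \<in> T" for x t
    proof -
      have xt: "x \<otimes> t \<in> carrier G" using that T by auto
      show ?thesis
        using v_nonneg[OF that(1)] v_nonneg[OF xt] v0[OF that(1)] v0[OF xt] m_pos
        by (auto simp: v_def indicator_def split: if_splits)
    qed
    have sIt: "fsupp (\<lambda>x. \<bar>indicator K x - indicator K (x \<otimes> t)\<bar>)" if "t \<in> T" for t
      using fsupp_combine2[OF sI fsupp_translate[OF sI]] that T by auto
    have svt: "fsupp (\<lambda>x. \<bar>v x - v (x \<otimes> t)\<bar>)" if "t \<in> T" for t
      using fsupp_combine2[OF sv fsupp_translate[OF sv]] that T by auto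
    have D: "(\<Sum>\<^sub>\<infinity>x\<in>carrier G. \<bar>u x - u (x \<otimes> t)\<bar>) = (\<Sum>\<^sub>\<infinity>x\<in>carrier G. \<bar>v x - v (x \<otimes> t)\<bar>)
        + m * (\<Sum>\<^sub>\<infinity>x\<in>carrier G. \<bar>indicator K x - indicator K (x \<otimes> t)\<bar>)" if "t \<in> T" for t
    proof -
      have "(\<Sum>\<^sub>\<infinity>x\<in>carrier G. \<bar>u x - u (x \<otimes> t)\<bar>) = (\<Sum>\<^sub>\<infinity>x\<in>carrier G. \<bar>v x - v (x \<otimes> t)\<bar>
          + m * \<bar>indicator K x - indicator K (x \<otimes> t)\<bar>)"
        using split that by (intro infsum_cong) auto
      also have "\<dots> = (\<Sum>\<^sub>\<infinity>x\<in>carrier G. \<bar>v x - v (x \<otimes> t)\<bar>)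
          + (\<Sum>\<^sub>\<infinity>x\<in>carrier G. m * \<bar>indicator K x - indicator K (x \<otimes> t)\<bar>)"
        using svt[OF that] sIt[OF that] by (intro infsum_add summable_on_cmult_right) auto
      finally show ?thesis by (simp add: infsum_cmult_right')
    qed
    obtain t where t: "t \<in> T" "\<epsilon> * real (card K) \<le> real (card {x \<in> K. x \<otimes> t \<notin> K})"
      using ex[OF K False] by blast
    have "real (card {x \<in> K. x \<otimes> t \<notin> K}) = (\<Sum>\<^sub>\<infinity>x\<in>carrier G. indicator {x \<in> K. x \<otimes> t \<notin> K} x)"
      using K by (intro infsum_indicator_finite[symmetric]) auto
    also have "\<dots> \<le> (\<Sum>\<^sub>\<infinity>x\<in>carrier G. \<bar>indicator K x - indicator K (x \<otimes> t)\<bar>)"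
      using K sIt[OF t(1)] by (intro infsum_mono fsupp_summable fsupp_indicator) (auto simp: indicator_def)
    also have "\<dots> \<le> (\<Sum>t\<in>T. \<Sum>\<^sub>\<infinity>x\<in>carrier G. \<bar>indicator K x - indicator K (x \<otimes> t)\<bar>)"
      using t T by (intro member_le_sum infsum_nonneg) auto
    finally have I: "\<epsilon> * real (card K)
        \<le> (\<Sum>t\<in>T. \<Sum>\<^sub>\<infinity>x\<in>carrier G. \<bar>indicator K x - indicator K (x \<otimes> t)\<bar>)"
      using t by linarith
    have "(\<Sum>\<^sub>\<infinity>x\<in>carrier G. u x) = (\<Sum>\<^sub>\<infinity>x\<in>carrier G. v x + m * indicator K x)"
      by (simp add: v_def)
    also have "\<dots> = (\<Sum>\<^sub>\<infinity>x\<in>carrier G. v x) + (\<Sum>\<^sub>\<infinity>x\<in>carrier G. m * indicator K x)"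
      using sv sI by (intro infsum_add summable_on_cmult_right) auto
    finally have U: "(\<Sum>\<^sub>\<infinity>x\<in>carrier G. u x) = (\<Sum>\<^sub>\<infinity>x\<in>carrier G. v x) + m * real (card K)"
      using infsum_indicator_finite[OF K] by (simp add: infsum_cmult_right')
    show ?thesis
      using IH mult_left_mono[OF I, of m] m_pos
      by (simp add: D U sum.distrib sum_distrib_left algebra_simps)
  qed
qed

text \<open>Cheeger's argument: the l^1 inequality is applied to f^2. Factoring a^2 - b^2 = (a -
  b)(a + b) and using a weighted arithmetic-geometric mean splits each difference into a large
  multiple of the energy and a small multiple of the norm, and the latter is absorbed on the
  left.\<close>

lemma expansion_imp_poincare:
  fixes f :: "'a \<Rightarrow> real"
  assumes T: "finite T" "T \<subseteq> carrier G" "T \<noteq> {}" and eps: "\<epsilon> > 0"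
    and ex: "\<And>K. finite K \<Longrightarrow> K \<subseteq> carrier G \<Longrightarrow> K \<noteq> {} \<Longrightarrow>
               \<exists>t\<in>T. \<epsilon> * real (card K) \<le> real (card {x \<in> K. x \<otimes> t \<notin> K})"
    and f: "fsupp f"
  shows "\<epsilon>\<^sup>2 / (4 * real (card T)) * (\<Sum>\<^sub>\<infinity>x\<in>carrier G. (f x)\<^sup>2)
           \<le> (\<Sum>t\<in>T. \<Sum>\<^sub>\<infinity>x\<in>carrier G. (f x - f (x \<otimes> t))\<^sup>2)"
proof -
  define N where "N = (\<Sum>\<^sub>\<infinity>x\<in>carrier G. (f x)\<^sup>2)"
  define E where "E t = (\<Sum>\<^sub>\<infinity>x\<in>carrier G. (f x - f (x \<otimes> t))\<^sup>2)" for t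
  define n where "n = real (card T)"
  have n: "n > 0" using T by (simp add: n_def card_gt_0_iff)
  \<comment> \<open>Each of the \<open>n\<close> elements of \<open>T\<close> contributes
    \<open>2 * \<delta> * N\<close> to the error. This choice makes the total
    \<open>\<epsilon> / 2 * N\<close>, half of the left-hand side.\<close>
  define \<delta> where "\<delta> = \<epsilon> / (4 * n)"
  have \<delta>: "\<delta> > 0" using eps n by (simp add: \<delta>_def)
  define \<kappa> where "\<kappa> = 1 / (2 * \<delta>)"
  have s2: "fsupp (\<lambda>x. (f x)\<^sup>2)" using f by (rule fsupp_combine) auto
  have s2t: "fsupp (\<lambda>x. (f (x \<otimes> t))\<^sup>2)" if "t \<in> T" for t
    using fsupp_translate[OF s2, of t] that T by auto
  have sE: "fsupp (\<lambda>x. (f x - f (x \<otimes> t))\<^sup>2)" if "t \<in> T" for t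
    using fsupp_combine2[OF s2 s2t[OF that]] by auto
  have sA: "fsupp (\<lambda>x. \<bar>(f x)\<^sup>2 - (f (x \<otimes> t))\<^sup>2\<bar>)" if "t \<in> T" for t
    using fsupp_combine2[OF s2 s2t[OF that]] by auto
  have pt: "\<bar>a\<^sup>2 - b\<^sup>2\<bar> \<le> \<kappa> * (a - b)\<^sup>2 + (\<delta> * a\<^sup>2 + \<delta> * b\<^sup>2)" for a b :: real
  proof -
    have "0 \<le> (\<bar>a - b\<bar> / \<delta> - \<bar>a + b\<bar>)\<^sup>2 * (\<delta> / 2)" using \<delta> by simp
    also have "\<dots> = 1 / (2 * \<delta>) * (a - b)\<^sup>2 + \<delta> / 2 * (a + b)\<^sup>2 - \<bar>a - b\<bar> * \<bar>a + b\<bar>"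
      using \<delta> by (simp add: power2_diff power_divide field_simps power2_eq_square)
    also have "\<bar>a - b\<bar> * \<bar>a + b\<bar> = \<bar>a\<^sup>2 - b\<^sup>2\<bar>"
      by (simp add: abs_mult[symmetric] power2_eq_square algebra_simps)
    also have "\<delta> / 2 * (a + b)\<^sup>2 = \<delta> * a\<^sup>2 + \<delta> * b\<^sup>2 - \<delta> / 2 * (a - b)\<^sup>2"
      by (simp add: power2_eq_square algebra_simps)
    finally have "\<bar>a\<^sup>2 - b\<^sup>2\<bar> + \<delta> / 2 * (a - b)\<^sup>2 \<le> \<kappa> * (a - b)\<^sup>2 + (\<delta> * a\<^sup>2 + \<delta> * b\<^sup>2)"
      by (simp add: \<kappa>_def)
    moreover have "0 \<le> \<delta> / 2 * (a - b)\<^sup>2" using \<delta> by simp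
    ultimately show ?thesis by linarith
  qed
  have A: "(\<Sum>\<^sub>\<infinity>x\<in>carrier G. \<bar>(f x)\<^sup>2 - (f (x \<otimes> t))\<^sup>2\<bar>) \<le> \<kappa> * E t + 2 * \<delta> * N"
    if "t \<in> T" for t
  proof -
    have "(\<Sum>\<^sub>\<infinity>x\<in>carrier G. \<bar>(f x)\<^sup>2 - (f (x \<otimes> t))\<^sup>2\<bar>)
        \<le> (\<Sum>\<^sub>\<infinity>x\<in>carrier G. \<kappa> * (f x - f (x \<otimes> t))\<^sup>2 + (\<delta> * (f x)\<^sup>2 + \<delta> * (f (x \<otimes> t))\<^sup>2))"
      using sA[OF that] sE[OF that] s2 s2t[OF that] pt
      by (intro infsum_mono summable_on_add summable_on_cmult_right) auto
    also have "\<dots> = (\<Sum>\<^sub>\<infinity>x\<in>carrier G. \<kappa> * (f x - f (x \<otimes> t))\<^sup>2)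
        + ((\<Sum>\<^sub>\<infinity>x\<in>carrier G. \<delta> * (f x)\<^sup>2) + (\<Sum>\<^sub>\<infinity>x\<in>carrier G. \<delta> * (f (x \<otimes> t))\<^sup>2))"
      using sE[OF that] s2 s2t[OF that]
      by (subst infsum_add infsum_add; (intro summable_on_add summable_on_cmult_right)?; simp)+
    also have "\<dots> = \<kappa> * E t + 2 * \<delta> * N"
      using infsum_translate[of t "\<lambda>x. (f x)\<^sup>2"] that T
      by (simp add: infsum_cmult_right' E_def N_def subset_iff)
    finally show ?thesis .
  qed
  have "\<epsilon> * N \<le> (\<Sum>t\<in>T. \<Sum>\<^sub>\<infinity>x\<in>carrier G. \<bar>(f x)\<^sup>2 - (f (x \<otimes> t))\<^sup>2\<bar>)"
    unfolding N_def using expansion_imp_l1_isoperimetry[OF T(1,2) ex s2] by simp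
  also have "\<dots> \<le> (\<Sum>t\<in>T. \<kappa> * E t + 2 * \<delta> * N)"
    by (rule sum_mono) (rule A)
  also have "\<dots> = \<kappa> * sum E T + n * (2 * \<delta> * N)"
    by (simp add: sum.distrib sum_distrib_left n_def)
  also have "\<dots> = 2 * n / \<epsilon> * sum E T + \<epsilon> / 2 * N"
    using n eps by (simp add: \<delta>_def \<kappa>_def)
  finally have "\<epsilon> / 2 * N \<le> 2 * n / \<epsilon> * sum E T" by linarith
  then show ?thesis
    using n eps unfolding n_def[symmetric] N_def[symmetric] E_def[symmetric]
    by (simp add: field_simps power2_eq_square)
qed

text \<open>The overview's operator P: since the sets \<open>T\<close> used are symmetric, this is
  convolution on the right by the uniform measure on \<open>T\<close>. It commutes with left
  translations of \<open>f\<close>.\<close>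

definition avg :: "'a set \<Rightarrow> ('a \<Rightarrow> real) \<Rightarrow> 'a \<Rightarrow> real" where
  "avg T f x = (\<Sum>t\<in>T. f (x \<otimes> t)) / real (card T)"

lemma fsupp_avg:
  assumes "finite T" "T \<subseteq> carrier G" "fsupp f"
  shows "fsupp (avg T f)"
proof (rule fsupp_combine)
  show "fsupp (\<lambda>x. \<Sum>t\<in>T. f (x \<otimes> t))"
    using assms by (intro fsupp_sum fsupp_translate) auto
qed (simp add: avg_def)

text \<open>The variance inequality, taken at the element \<open>\<one>\<close> of \<open>T\<close>
  and summed over \<open>x\<close>, says that n^2 times the new squared norm plus the energy is at
  most n^2 times the old one, where n = \<open>card T\<close>. The Poincare inequality bounds the
  energy below by \<epsilon>^2/(4n) times the old squared norm; division by n^2 produces the cube in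
  the constant.\<close>

lemma expansion_imp_avg_contraction:
  assumes T: "finite T" "T \<subseteq> carrier G" "\<one> \<in> T" and eps: "\<epsilon> > 0"
    and ex: "\<And>K. finite K \<Longrightarrow> K \<subseteq> carrier G \<Longrightarrow> K \<noteq> {} \<Longrightarrow>
               \<exists>t\<in>T. \<epsilon> * real (card K) \<le> real (card {x \<in> K. x \<otimes> t \<notin> K})"
    and f: "fsupp f"
  shows "(\<Sum>\<^sub>\<infinity>x\<in>carrier G. (avg T f x)\<^sup>2)
           \<le> (1 - \<epsilon>\<^sup>2 / (4 * real (card T) ^ 3)) * (\<Sum>\<^sub>\<infinity>x\<in>carrier G. (f x)\<^sup>2)"
proof -
  define N where "N = (\<Sum>\<^sub>\<infinity>x\<in>carrier G. (f x)\<^sup>2)"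
  define E where "E t = (\<Sum>\<^sub>\<infinity>x\<in>carrier G. (f x - f (x \<otimes> t))\<^sup>2)" for t
  define n where "n = real (card T)"
  have n: "n > 0" and T_ne: "T \<noteq> {}" using T by (auto simp: n_def card_gt_0_iff)
  have P: "\<epsilon>\<^sup>2 / (4 * n) * N \<le> sum E T"
    unfolding N_def E_def n_def using T by (intro expansion_imp_poincare eps ex f) auto
  have s2: "fsupp (\<lambda>x. (f x)\<^sup>2)" using f by (rule fsupp_combine) auto
  have s2t: "fsupp (\<lambda>x. (f (x \<otimes> t))\<^sup>2)" if "t \<in> T" for t
    using fsupp_translate[OF s2, of t] that T by auto
  have sE: "fsupp (\<lambda>x. (f x - f (x \<otimes> t))\<^sup>2)" if "t \<in> T" for t
    using fsupp_combine2[OF s2 s2t[OF that]] by auto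
  have sAE: "fsupp (\<lambda>x. (\<Sum>t\<in>T. f (x \<otimes> t))\<^sup>2)"
    using fsupp_avg[OF T(1,2) f] by (rule fsupp_combine) (use n in \<open>auto simp: avg_def n_def\<close>)
  have "n\<^sup>2 * (\<Sum>\<^sub>\<infinity>x\<in>carrier G. (avg T f x)\<^sup>2) + sum E T
      = (\<Sum>\<^sub>\<infinity>x\<in>carrier G. (\<Sum>t\<in>T. f (x \<otimes> t))\<^sup>2) + (\<Sum>\<^sub>\<infinity>x\<in>carrier G. \<Sum>t\<in>T. (f x - f (x \<otimes> t))\<^sup>2)"
    using n T sE T_ne unfolding E_def n_def
    by (simp add: infsum_sum_fsupp avg_def power_divide infsum_cmult_right'[symmetric])
  also have "\<dots> = (\<Sum>\<^sub>\<infinity>x\<in>carrier G. (\<Sum>t\<in>T. f (x \<otimes> t))\<^sup>2 + (\<Sum>t\<in>T. (f x - f (x \<otimes> t))\<^sup>2))"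
    using sAE sE T by (intro infsum_add[symmetric] fsupp_summable fsupp_sum) auto
  also have "\<dots> \<le> (\<Sum>\<^sub>\<infinity>x\<in>carrier G. n * (\<Sum>t\<in>T. (f (x \<otimes> t))\<^sup>2))"
  proof (rule infsum_mono)
    show "(\<lambda>x. (\<Sum>t\<in>T. f (x \<otimes> t))\<^sup>2 + (\<Sum>t\<in>T. (f x - f (x \<otimes> t))\<^sup>2)) summable_on carrier G"
      using sAE sE T by (intro summable_on_add fsupp_summable fsupp_sum) auto
    show "(\<lambda>x. n * (\<Sum>t\<in>T. (f (x \<otimes> t))\<^sup>2)) summable_on carrier G"
      using s2t T by (intro summable_on_cmult_right fsupp_summable fsupp_sum) auto
    show "(\<Sum>t\<in>T. f (x \<otimes> t))\<^sup>2 + (\<Sum>t\<in>T. (f x - f (x \<otimes> t))\<^sup>2) \<le> n * (\<Sum>t\<in>T. (f (x \<otimes> t))\<^sup>2)"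
      if "x \<in> carrier G" for x
      using square_sum_add_deviation_le[of T \<one> "\<lambda>t. f (x \<otimes> t)"] T that by (simp add: n_def)
  qed
  also have "\<dots> = n * (\<Sum>t\<in>T. \<Sum>\<^sub>\<infinity>x\<in>carrier G. (f (x \<otimes> t))\<^sup>2)"
    using s2t T by (simp add: infsum_cmult_right' infsum_sum_fsupp)
  also have "\<dots> = n\<^sup>2 * N"
    using infsum_translate[of _ "\<lambda>x. (f x)\<^sup>2"] T
    by (simp add: subset_iff N_def n_def power2_eq_square)
  finally have "n\<^sup>2 * (\<Sum>\<^sub>\<infinity>x\<in>carrier G. (avg T f x)\<^sup>2) \<le> n\<^sup>2 * N - \<epsilon>\<^sup>2 / (4 * n) * N"
    using P by linarith
  also have "\<dots> = n\<^sup>2 * ((1 - \<epsilon>\<^sup>2 / (4 * n ^ 3)) * N)"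
    using n by (simp add: field_simps power2_eq_square power3_eq_cube)
  finally show ?thesis
    using n by (simp add: N_def n_def)
qed

end

section \<open>Convolution powers\<close>

lemma sqrt_power_square: "c \<ge> 0 \<Longrightarrow> (sqrt c ^ n)\<^sup>2 = c ^ n"
  unfolding real_sqrt_power[symmetric] by simp

context group
begin

primrec walk :: "'a set \<Rightarrow> nat \<Rightarrow> 'a \<Rightarrow> real" where
  "walk T 0 = indicator {\<one>}"
| "walk T (Suc n) = avg T (walk T n)"

lemma walk_nonneg: "walk T n x \<ge> 0"
  by (induction n arbitrary: x) (auto simp: avg_def intro!: divide_nonneg_nonneg sum_nonneg)

context
  fixes T assumes T: "finite T" "T \<subseteq> carrier G" "\<one> \<in> T" "\<And>t. t \<in> T \<Longrightarrow> inv t \<in> T"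
begin

lemma fsupp_walk: "fsupp (walk T n)"
  by (induction n) (simp_all add: fsupp_indicator fsupp_avg T(1,2))

text \<open>Averaging on the left commutes with averaging on the right, and both agree on the
  indicator of \<open>\<one>\<close>. The left form of the recursion serves for the symmetry of the
  walk and for reading off words that spell the elements of its support.\<close>

lemma walk_Suc_left:
  "x \<in> carrier G \<Longrightarrow> walk T (Suc n) x = (\<Sum>t\<in>T. walk T n (t \<otimes> x)) / real (card T)"
proof (induction n arbitrary: x)
  case 0
  have "x \<otimes> t = \<one> \<longleftrightarrow> t \<otimes> x = \<one>" if "t \<in> T" for t
    using inv_comm[of x t] inv_comm[of t x] that T 0 by auto
  then show ?case by (simp add: avg_def indicator_def)
next
  case (Suc n)
  have "walk T (Suc (Suc n)) x = (\<Sum>t\<in>T. walk T (Suc n) (x \<otimes> t)) / real (card T)"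
    by (simp add: avg_def)
  also have "\<dots> = (\<Sum>t\<in>T. \<Sum>s\<in>T. walk T n (s \<otimes> (x \<otimes> t))) / real (card T) / real (card T)"
    using T Suc by (simp add: Suc.IH subset_iff sum_divide_distrib[symmetric] del: walk.simps)
  also have "(\<Sum>t\<in>T. \<Sum>s\<in>T. walk T n (s \<otimes> (x \<otimes> t))) = (\<Sum>s\<in>T. \<Sum>t\<in>T. walk T n (s \<otimes> x \<otimes> t))"
    using T Suc.prems by (subst sum.swap) (auto intro!: sum.cong simp: m_assoc subset_iff)
  also have "\<dots> / real (card T) / real (card T) = (\<Sum>s\<in>T. walk T (Suc n) (s \<otimes> x)) / real (card T)"
    by (simp add: avg_def sum_divide_distrib)
  finally show ?case .
qed

text \<open>Inversion turns a right step by \<open>t\<close> into a left step by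
  \<open>inv t\<close>, and \<open>T\<close> is closed under inverses; the left recursion then
  closes the induction.\<close>

lemma walk_inv: "x \<in> carrier G \<Longrightarrow> walk T n (inv x) = walk T n x"
proof (induction n arbitrary: x)
  case 0
  then show ?case by (auto simp: indicator_def)
next
  case (Suc n)
  have bij: "bij_betw (m_inv G) T T"
    by (rule bij_betw_byWitness[of _ "m_inv G"]) (use T in auto)
  have "walk T (Suc n) (inv x) = (\<Sum>t\<in>T. walk T n (inv x \<otimes> t)) / real (card T)"
    by (simp add: avg_def)
  also have "(\<Sum>t\<in>T. walk T n (inv x \<otimes> t)) = (\<Sum>t\<in>T. walk T n (inv t \<otimes> x))"
  proof (rule sum.cong)
    fix t assume "t \<in> T"
    then have t: "t \<in> carrier G" using T by auto
    then have "inv x \<otimes> t = inv (inv t \<otimes> x)" using Suc.prems by (simp add: inv_mult_group)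
    then show "walk T n (inv x \<otimes> t) = walk T n (inv t \<otimes> x)"
      using Suc.IH[of "inv t \<otimes> x"] t Suc.prems by simp
  qed simp
  also have "\<dots> = (\<Sum>t\<in>T. walk T n (t \<otimes> x))"
    by (rule sum.reindex_bij_betw[OF bij])
  finally show ?case using walk_Suc_left[OF Suc.prems] by simp
qed

lemma infsum_avg:
  assumes "fsupp f"
  shows "(\<Sum>\<^sub>\<infinity>x\<in>carrier G. avg T f x) = (\<Sum>\<^sub>\<infinity>x\<in>carrier G. f x)"
proof -
  have "card T > 0" using T by (auto simp: card_gt_0_iff)
  moreover have "(\<Sum>\<^sub>\<infinity>x\<in>carrier G. \<Sum>t\<in>T. f (x \<otimes> t)) = (\<Sum>t\<in>T. \<Sum>\<^sub>\<infinity>x\<in>carrier G. f (x \<otimes> t))"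
    using T assms by (intro infsum_sum_fsupp fsupp_translate) auto
  moreover have "\<dots> = (\<Sum>t\<in>T. \<Sum>\<^sub>\<infinity>x\<in>carrier G. f x)"
    using T by (intro sum.cong infsum_translate) auto
  ultimately show ?thesis
    unfolding avg_def divide_inverse infsum_cmult_left' by simp
qed

lemma infsum_walk: "(\<Sum>\<^sub>\<infinity>x\<in>carrier G. walk T n x) = 1"
proof (induction n)
  case 0
  then show ?case using infsum_indicator_finite[of "{\<one>}"] by simp
next
  case (Suc n)
  then show ?case using infsum_avg[OF fsupp_walk, of n] by simp
qed

lemma sym_prob_walk: "sym_prob G (walk T n)"
  unfolding sym_prob_def
  using has_sum_infsum[OF fsupp_summable[OF fsupp_walk]] walk_nonneg walk_inv infsum_walk by metis

lemma fsupp_sum_walk: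
  "finite K \<Longrightarrow> K \<subseteq> carrier G \<Longrightarrow> fsupp (\<lambda>x. \<Sum>g\<in>K. walk T n (inv g \<otimes> x))"
  by (intro fsupp_sum fsupp_left_translate fsupp_walk) auto

text \<open>The sum over \<open>K\<close> is the n-fold average of the indicator of
  \<open>K\<close>, because \<open>avg\<close> commutes with left translations; the starting squared
  norm is \<open>card K\<close>. Taking \<open>K = {\<one>}\<close> gives the pointwise decay of the
  walk, general \<open>K\<close> the bound on internal weights.\<close>

lemma l2_sum_walk_le:
  assumes K: "finite K" "K \<subseteq> carrier G" and c: "c \<ge> 0"
    and contr: "\<And>f. fsupp f \<Longrightarrow>
      (\<Sum>\<^sub>\<infinity>x\<in>carrier G. (avg T f x)\<^sup>2) \<le> c * (\<Sum>\<^sub>\<infinity>x\<in>carrier G. (f x)\<^sup>2)"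
  shows "(\<Sum>\<^sub>\<infinity>x\<in>carrier G. (\<Sum>g\<in>K. walk T n (inv g \<otimes> x))\<^sup>2) \<le> c ^ n * real (card K)"
proof (induction n)
  case 0
  have "(\<Sum>g\<in>K. walk T 0 (inv g \<otimes> x))\<^sup>2 = indicator K x" if "x \<in> carrier G" for x
  proof -
    have "(\<Sum>g\<in>K. walk T 0 (inv g \<otimes> x)) = (\<Sum>g\<in>K. indicator {x} g)"
    proof (rule sum.cong)
      fix g assume "g \<in> K"
      then have g: "g \<in> carrier G" using K by auto
      have "inv g \<otimes> x = \<one> \<longleftrightarrow> x = g" using inv_equality that g by (metis inv_inv inv_closed l_inv)
      then show "walk T 0 (inv g \<otimes> x) = indicator {x} g" by (auto simp: indicator_def)
    qed simp
    also have "\<dots> = indicator K x"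
      using K by (simp add: indicator_def sum.If_cases)
    finally show ?thesis by (simp add: indicator_def)
  qed
  then have "(\<Sum>\<^sub>\<infinity>x\<in>carrier G. (\<Sum>g\<in>K. walk T 0 (inv g \<otimes> x))\<^sup>2)
      = (\<Sum>\<^sub>\<infinity>x\<in>carrier G. indicator K x)"
    by (intro infsum_cong) auto
  then show ?case using infsum_indicator_finite[OF K] by simp
next
  case (Suc n)
  have "(\<Sum>g\<in>K. walk T (Suc n) (inv g \<otimes> x)) = avg T (\<lambda>x. \<Sum>g\<in>K. walk T n (inv g \<otimes> x)) x"
    if "x \<in> carrier G" for x
    unfolding walk.simps avg_def sum_divide_distrib[symmetric]
    by (subst sum.swap) (use T K that in \<open>auto intro!: sum.cong arg_cong2[where f = "(/)"] simp: m_assoc subset_iff\<close>)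
  then have "(\<Sum>\<^sub>\<infinity>x\<in>carrier G. (\<Sum>g\<in>K. walk T (Suc n) (inv g \<otimes> x))\<^sup>2)
     = (\<Sum>\<^sub>\<infinity>x\<in>carrier G. (avg T (\<lambda>x. \<Sum>g\<in>K. walk T n (inv g \<otimes> x)) x)\<^sup>2)"
    by (intro infsum_cong) auto
  also have "\<dots> \<le> c * (\<Sum>\<^sub>\<infinity>x\<in>carrier G. (\<Sum>g\<in>K. walk T n (inv g \<otimes> x))\<^sup>2)"
    by (rule contr) (rule fsupp_sum_walk[OF K])
  also have "\<dots> \<le> c * (c ^ n * real (card K))"
    using Suc c by (rule mult_left_mono)
  finally show ?case by simp
qed

lemma walk_le:
  assumes c: "c \<ge> 0"
    and contr: "\<And>f. fsupp f \<Longrightarrow>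
      (\<Sum>\<^sub>\<infinity>x\<in>carrier G. (avg T f x)\<^sup>2) \<le> c * (\<Sum>\<^sub>\<infinity>x\<in>carrier G. (f x)\<^sup>2)"
    and x: "x \<in> carrier G"
  shows "walk T n x \<le> sqrt c ^ n"
proof -
  have s2: "fsupp (\<lambda>x. (walk T n x)\<^sup>2)"
    using fsupp_walk by (rule fsupp_combine) simp
  have "(walk T n x)\<^sup>2 = (\<Sum>x\<in>{x}. (walk T n x)\<^sup>2)" by simp
  also have "\<dots> \<le> (\<Sum>\<^sub>\<infinity>x\<in>carrier G. (walk T n x)\<^sup>2)"
    using x s2 by (intro finite_sum_le_infsum) auto
  also have "\<dots> = (\<Sum>\<^sub>\<infinity>x\<in>carrier G. (\<Sum>g\<in>{\<one>}. walk T n (inv g \<otimes> x))\<^sup>2)"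
    by (intro infsum_cong) simp
  also have "\<dots> \<le> c ^ n" using l2_sum_walk_le[of "{\<one>}" c n] c contr by simp
  also have "\<dots> = (sqrt c ^ n)\<^sup>2" using c by (simp add: sqrt_power_square)
  finally show ?thesis using c by (auto intro: power2_le_imp_le)
qed

text \<open>The double sum is the inner product of the indicator of \<open>K\<close> with its n-fold
  average. Cauchy-Schwarz contributes one factor \<open>sqrt (card K)\<close>, the norm of the
  average contributes the other together with \<open>sqrt c ^ n\<close>.\<close>

lemma sum_walk_le:
  assumes K: "finite K" "K \<subseteq> carrier G" and c: "c \<ge> 0"
    and contr: "\<And>f. fsupp f \<Longrightarrow>
      (\<Sum>\<^sub>\<infinity>x\<in>carrier G. (avg T f x)\<^sup>2) \<le> c * (\<Sum>\<^sub>\<infinity>x\<in>carrier G. (f x)\<^sup>2)"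
  shows "(\<Sum>g\<in>K. \<Sum>h\<in>K. walk T n (inv g \<otimes> h)) \<le> sqrt c ^ n * real (card K)"
proof -
  let ?F = "\<lambda>x. \<Sum>g\<in>K. walk T n (inv g \<otimes> x)"
  have s2: "fsupp (\<lambda>x. (?F x)\<^sup>2)"
    using fsupp_sum_walk[OF K] by (rule fsupp_combine) simp
  have "(\<Sum>x\<in>K. ?F x)\<^sup>2 \<le> (\<Sum>x\<in>K. (?F x)\<^sup>2) * real (card K)"
    by (rule sum_squared_le_sum_of_squares)
  also have "(\<Sum>x\<in>K. (?F x)\<^sup>2) \<le> (\<Sum>\<^sub>\<infinity>x\<in>carrier G. (?F x)\<^sup>2)"
    using s2 K by (intro finite_sum_le_infsum) auto
  also have "\<dots> \<le> c ^ n * real (card K)"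
    using l2_sum_walk_le[OF K c contr] by simp
  also have "c ^ n * real (card K) * real (card K) = (sqrt c ^ n * real (card K))\<^sup>2"
    using c by (simp add: power_mult_distrib sqrt_power_square power2_eq_square[of "real (card K)"])
  finally have "(\<Sum>x\<in>K. ?F x) \<le> sqrt c ^ n * real (card K)"
    using c by (auto intro: power2_le_imp_le simp: mult_right_mono)
  then show ?thesis by (subst sum.swap)
qed

end

lemma walk_support:
  assumes S: "S \<subseteq> carrier G" and fin: "finite S"
  defines "T \<equiv> insert \<one> (S \<union> m_inv G ` S)"
  assumes x: "x \<in> carrier G" "walk T n x \<noteq> 0"
  shows "word_length G S x \<le> n"
proof -
  have T: "finite T" "T \<subseteq> carrier G" "\<one> \<in> T" "\<And>t. t \<in> T \<Longrightarrow> inv t \<in> T"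
    using S fin by (auto simp: T_def)
  have "\<exists>xs. length xs \<le> n \<and> set xs \<subseteq> S \<union> m_inv G ` S \<and> foldr (\<lambda>x y. x \<otimes> y) xs \<one> = x"
    using x
  proof (induction n arbitrary: x)
    case 0
    then show ?case by (auto simp: indicator_def split: if_splits)
  next
    case (Suc n)
    have "(\<Sum>t\<in>T. walk T n (t \<otimes> x)) \<noteq> 0"
      using walk_Suc_left[OF T Suc.prems(1), of n] Suc.prems(2) by auto
    then obtain t where t: "t \<in> T" "walk T n (t \<otimes> x) \<noteq> 0"
      by (meson sum.neutral)
    have tc: "t \<in> carrier G" using t T by auto
    obtain xs where xs: "length xs \<le> n" "set xs \<subseteq> S \<union> m_inv G ` S"
        "foldr (\<lambda>x y. x \<otimes> y) xs \<one> = t \<otimes> x"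
      using Suc.IH[OF _ t(2)] tc Suc.prems by auto
    show ?case
    proof (cases "t = \<one>")
      case True
      then show ?thesis using xs Suc.prems by (intro exI[of _ xs]) auto
    next
      case False
      \<comment> \<open>The left recursion leads from \<open>x\<close> to
        \<open>t \<otimes> x\<close>, so the letter to prepend is \<open>inv t\<close>; an identity
        step adds no letter, which is why lengths are only bounded by \<open>n\<close>.\<close>
      then have "inv t \<in> S \<union> m_inv G ` S" using t S by (auto simp: T_def)
      moreover have "inv t \<otimes> (t \<otimes> x) = x" using tc Suc.prems by (simp add: m_assoc[symmetric])
      ultimately show ?thesis using xs by (intro exI[of _ "inv t # xs"]) auto
    qed
  qed
  then obtain xs where xs: "length xs \<le> n" "set xs \<subseteq> S \<union> m_inv G ` S"
      "foldr (\<lambda>x y. x \<otimes> y) xs \<one> = x" by blast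
  then have "word_length G S x \<le> length xs"
    unfolding word_length_def by (intro Least_le) auto
  with xs show ?thesis by simp
qed

text \<open>Inversion turns left translates into right translates.\<close>

lemma right_expansion:
  assumes s: "s \<in> carrier G" and K: "finite K" "K \<subseteq> carrier G"
    and ex: "\<epsilon> * real (card (m_inv G ` K)) \<le> real (card ((\<lambda>x. s \<otimes> x) ` m_inv G ` K - m_inv G ` K))"
  shows "\<epsilon> * real (card K) \<le> real (card {x \<in> K. x \<otimes> inv s \<notin> K})"
proof -
  have "card (m_inv G ` K) = card K"
    using K inv_inj by (intro card_image) (auto simp: inj_on_def subset_iff)
  moreover have "(\<lambda>x. s \<otimes> x) ` m_inv G ` K - m_inv G ` K \<subseteq> (\<lambda>x. s \<otimes> inv x) ` {x \<in> K. x \<otimes> inv s \<notin> K}"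
  proof
    fix y assume y: "y \<in> (\<lambda>x. s \<otimes> x) ` m_inv G ` K - m_inv G ` K"
    then obtain x where x: "x \<in> K" "y = s \<otimes> inv x" by auto
    have "inv (x \<otimes> inv s) = y" using x s K by (simp add: inv_mult_group subset_iff)
    then have "x \<otimes> inv s \<notin> K" using y by auto
    then show "y \<in> (\<lambda>x. s \<otimes> inv x) ` {x \<in> K. x \<otimes> inv s \<notin> K}" using x by auto
  qed
  then have "card ((\<lambda>x. s \<otimes> x) ` m_inv G ` K - m_inv G ` K) \<le> card {x \<in> K. x \<otimes> inv s \<notin> K}"
    using K by (intro surj_card_le) auto
  ultimately show ?thesis using ex by simp
qed

lemma nonamenable_spread_measures:
  assumes S: "finite S" "S \<subseteq> carrier G" "generate G S = carrier G" "\<not> amenable G"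
  obtains \<rho> :: real and \<mu> :: "nat \<Rightarrow> 'a \<Rightarrow> real" where "0 < \<rho>" "\<rho> < 1"
    "\<And>n. sym_prob G (\<mu> n)" "\<And>n. finite {x \<in> carrier G. \<mu> n x \<noteq> 0}"
    "\<And>n x. x \<in> carrier G \<Longrightarrow> \<mu> n x \<le> \<rho> ^ n"
    "\<And>n x. x \<in> carrier G \<Longrightarrow> \<mu> n x \<noteq> 0 \<Longrightarrow> word_length G S x \<le> n"
    "\<And>n K. finite K \<Longrightarrow> K \<subseteq> carrier G \<Longrightarrow>
       (\<Sum>g\<in>K. \<Sum>h\<in>K. \<mu> n (inv g \<otimes> h)) \<le> \<rho> ^ n * real (card K)"
proof -
  obtain \<epsilon> where eps: "\<epsilon> > 0"
    "\<And>K. finite K \<Longrightarrow> K \<subseteq> carrier G \<Longrightarrow> K \<noteq> {} \<Longrightarrow>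
       \<exists>s\<in>S. \<epsilon> * real (card K) \<le> real (card ((\<lambda>x. s \<otimes> x) ` K - K))"
    using nonamenable_expansion[OF S(2-4)] by blast
  define T where "T = insert \<one> (S \<union> m_inv G ` S)"
  have T: "finite T" "T \<subseteq> carrier G" "\<one> \<in> T" "\<And>t. t \<in> T \<Longrightarrow> inv t \<in> T"
    using S by (auto simp: T_def)
  have ex: "\<exists>t\<in>T. \<epsilon> * real (card K) \<le> real (card {x \<in> K. x \<otimes> t \<notin> K})"
    if K: "finite K" "K \<subseteq> carrier G" "K \<noteq> {}" for K
  proof -
    obtain s where "s \<in> S" "\<epsilon> * real (card (m_inv G ` K))
        \<le> real (card ((\<lambda>x. s \<otimes> x) ` m_inv G ` K - m_inv G ` K))"
      using eps(2)[of "m_inv G ` K"] K by auto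
    then show ?thesis
      using right_expansion[of s K \<epsilon>] K S by (intro bexI[of _ "inv s"]) (auto simp: T_def)
  qed
  \<comment> \<open>The maximum with 1/2 keeps the contraction constant positive whatever the size
    of \<open>\<epsilon>\<close>. As \<open>c\<close> contracts squared norms, the rate for the norm
    is \<open>sqrt c\<close>.\<close>
  define c where "c = max (1 / 2) (1 - \<epsilon>\<^sup>2 / (4 * real (card T) ^ 3))"
  have "card T > 0" using T by (auto simp: card_gt_0_iff)
  then have c: "0 < c" "c < 1" using eps by (auto simp: c_def less_max_iff_disj)
  have contr: "(\<Sum>\<^sub>\<infinity>x\<in>carrier G. (avg T f x)\<^sup>2) \<le> c * (\<Sum>\<^sub>\<infinity>x\<in>carrier G. (f x)\<^sup>2)" if "fsupp f" for f
    by (rule order_trans[OF expansion_imp_avg_contraction[OF T(1-3) eps(1) ex that]])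
       (auto simp: c_def intro!: mult_right_mono infsum_nonneg)
  show ?thesis
  proof (rule that[of "sqrt c" "walk T"])
    show "finite {x \<in> carrier G. walk T n x \<noteq> 0}" for n
      using fsupp_walk[OF T, of n] by (simp add: fsupp_def)
    show "x \<in> carrier G \<Longrightarrow> walk T n x \<le> sqrt c ^ n" for n x
      using walk_le[OF T _ contr, of x n] c by simp
    show "x \<in> carrier G \<Longrightarrow> walk T n x \<noteq> 0 \<Longrightarrow> word_length G S x \<le> n" for n x
      using walk_support[of S x n] S by (simp add: T_def)
    show "finite K \<Longrightarrow> K \<subseteq> carrier G \<Longrightarrow>
       (\<Sum>g\<in>K. \<Sum>h\<in>K. walk T n (inv g \<otimes> h)) \<le> sqrt c ^ n * real (card K)" for n K
      using sum_walk_le[OF T _ _ _ contr, of K n] c by simp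
  qed (use c sym_prob_walk[OF T] in auto)
qed

end

section \<open>Random subsets, spanning trees and self-avoiding paths\<close>

lemma poisson_prob_zero: "m \<ge> 0 \<Longrightarrow> measure_pmf.prob (poisson m) {0} = exp (- m)"
  by (cases "m = 0") (auto simp: poisson_def measure_pmf_single)

lemma poisson_prob_pos: "m \<ge> 0 \<Longrightarrow> measure_pmf.prob (poisson m) {0<..} = 1 - exp (- m)"
  using measure_pmf.prob_compl[of "{0}" "poisson m"] poisson_prob_zero[of m]
  by (simp add: Compl_eq_Diff_UNIV[symmetric] greaterThan_def Compl_eq)

lemma poisson_product_box:
  fixes w :: "'e \<Rightarrow> real"
  assumes "finite A" "finite B" "A \<inter> B = {}" "A \<subseteq> I" "B \<subseteq> I" and w: "\<And>e. e \<in> I \<Longrightarrow> w e \<ge> 0"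
  defines "M \<equiv> \<Pi>\<^sub>M e\<in>I. measure_pmf (poisson (w e))"
  shows "measure M {\<omega> \<in> space M. (\<forall>e\<in>A. \<omega> e > 0) \<and> (\<forall>e\<in>B. \<omega> e = 0)} =
           (\<Prod>e\<in>A. 1 - exp (- w e)) * (\<Prod>e\<in>B. exp (- w e))"
proof -
  interpret product_prob_space "\<lambda>e. measure_pmf (poisson (w e))" I
    by unfold_locales
  define X where "X e = (if e \<in> A then {0<..} else {0 :: nat})" for e
  have "{\<omega> \<in> space M. (\<forall>e\<in>A. \<omega> e > 0) \<and> (\<forall>e\<in>B. \<omega> e = 0)} = {\<omega> \<in> space M. \<forall>e\<in>A \<union> B. \<omega> e \<in> X e}"
    using assms(3) by (auto simp: X_def)
  also have "measure M \<dots> = (\<Prod>e\<in>A \<union> B. measure_pmf.prob (poisson (w e)) (X e))"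
  proof -
    have "emeasure M {\<omega> \<in> space M. \<forall>e\<in>A \<union> B. \<omega> e \<in> X e} =
        (\<Prod>e\<in>A \<union> B. emeasure (measure_pmf (poisson (w e))) (X e))"
      unfolding M_def by (rule emeasure_PiM_Collect) (use assms(1,2,4,5) in auto)
    also have "\<dots> = ennreal (\<Prod>e\<in>A \<union> B. measure_pmf.prob (poisson (w e)) (X e))"
      by (simp add: measure_pmf.emeasure_eq_measure prod_ennreal)
    finally show ?thesis by (simp add: measure_def prod_nonneg)
  qed
  also have "\<dots> = (\<Prod>e\<in>A. measure_pmf.prob (poisson (w e)) (X e)) * (\<Prod>e\<in>B. measure_pmf.prob (poisson (w e)) (X e))"
    by (rule prod.union_disjoint) (rule assms)+
  also have "(\<Prod>e\<in>A. measure_pmf.prob (poisson (w e)) (X e)) = (\<Prod>e\<in>A. 1 - exp (- w e))"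
    using w assms(4) by (intro prod.cong) (auto simp: X_def poisson_prob_pos subset_iff)
  also have "(\<Prod>e\<in>B. measure_pmf.prob (poisson (w e)) (X e)) = (\<Prod>e\<in>B. exp (- w e))"
    using w assms(3,5) by (intro prod.cong) (auto simp: X_def poisson_prob_zero subset_iff)
  finally show ?thesis .
qed

text \<open>The expectation of \<open>f\<close> at a random subset of \<open>I\<close> containing each \<open>e\<close> independently
  with probability \<open>p e\<close>.\<close>

definition random_subset_expectation :: "('e \<Rightarrow> real) \<Rightarrow> 'e set \<Rightarrow> ('e set \<Rightarrow> real) \<Rightarrow> real" where
  "random_subset_expectation p I f = (\<Sum>E\<in>Pow I. (\<Prod>e\<in>E. p e) * (\<Prod>e\<in>I - E. 1 - p e) * f E)"

lemma random_subset_expectation_insert: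
  assumes "finite I" "a \<notin> I"
  shows "random_subset_expectation p (insert a I) f =
    p a * random_subset_expectation p I (\<lambda>E. f (insert a E)) + (1 - p a) * random_subset_expectation p I f"
proof -
  let ?t = "\<lambda>E. (\<Prod>e\<in>E. p e) * (\<Prod>e\<in>insert a I - E. 1 - p e) * f E"
  have "random_subset_expectation p (insert a I) f = sum ?t (Pow I) + sum ?t (insert a ` Pow I)"
    unfolding random_subset_expectation_def Pow_insert
    using assms by (intro sum.union_disjoint) auto
  also have "sum ?t (Pow I) = (1 - p a) * random_subset_expectation p I f"
    unfolding random_subset_expectation_def sum_distrib_left
  proof (rule sum.cong)
    fix E assume "E \<in> Pow I"
    then have E: "finite (I - E)" "insert a I - E = insert a (I - E)" "a \<notin> I - E"
      using assms by auto
    show "?t E = (1 - p a) * ((\<Prod>e\<in>E. p e) * (\<Prod>e\<in>I - E. 1 - p e) * f E)"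
      unfolding E(2) using E by simp
  qed simp
  also have "sum ?t (insert a ` Pow I) = sum (?t \<circ> insert a) (Pow I)"
    using assms by (intro sum.reindex) (auto simp: inj_on_def)
  also have "\<dots> = p a * random_subset_expectation p I (\<lambda>E. f (insert a E))"
    unfolding random_subset_expectation_def sum_distrib_left
  proof (rule sum.cong)
    fix E assume "E \<in> Pow I"
    then have E: "finite E" "insert a I - insert a E = I - E" "a \<notin> E"
      using assms finite_subset by auto
    show "(?t \<circ> insert a) E = p a * ((\<Prod>e\<in>E. p e) * (\<Prod>e\<in>I - E. 1 - p e) * f (insert a E))"
      unfolding o_def E(2) using E by simp
  qed simp
  finally show ?thesis by simp
qed

lemma random_subset_expectation_linear:
  "random_subset_expectation p I (\<lambda>E. a * f E + b * g E) =
     a * random_subset_expectation p I f + b * random_subset_expectation p I g"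
  by (simp add: random_subset_expectation_def sum_distrib_left sum.distrib[symmetric] algebra_simps)

lemma random_subset_expectation_mono:
  assumes "\<And>e. e \<in> I \<Longrightarrow> 0 \<le> p e" "\<And>e. e \<in> I \<Longrightarrow> p e \<le> 1" "\<And>E. E \<subseteq> I \<Longrightarrow> f E \<le> g E"
  shows "random_subset_expectation p I f \<le> random_subset_expectation p I g"
  unfolding random_subset_expectation_def
  using assms by (intro sum_mono mult_left_mono mult_nonneg_nonneg prod_nonneg) auto

text \<open>Keeping each element with probability \<open>\<theta>\<close> preserves a given subset \<open>T\<close> with
  probability \<open>\<theta> ^ card T\<close>.\<close>

lemma random_subset_expectation_thinning:
  assumes "finite I" and \<theta>: "0 \<le> \<theta>" "\<theta> \<le> 1"
    and p: "\<And>e. e \<in> I \<Longrightarrow> 0 \<le> p e" "\<And>e. e \<in> I \<Longrightarrow> p e \<le> 1"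
    and q: "\<And>e. e \<in> I \<Longrightarrow> \<theta> * p e \<le> q e" "\<And>e. e \<in> I \<Longrightarrow> q e \<le> 1"
    and g: "\<And>E. 0 \<le> g E" "\<And>E F. E \<subseteq> F \<Longrightarrow> g E \<le> g F"
    and fg: "\<And>E. E \<subseteq> I \<Longrightarrow> \<exists>T\<subseteq>E. f E \<le> \<theta> ^ card T * g T"
  shows "random_subset_expectation p I f \<le> random_subset_expectation q I g"
  using assms(1) p q g fg
proof (induction I arbitrary: f g rule: finite_induct)
  case empty
  then show ?case using empty(7)[of "{}"] by (simp add: random_subset_expectation_def)
next
  case (insert a I)
  \<comment> \<open>\<open>h E\<close> is the mean of \<open>g\<close> when \<open>a\<close> is
    added to \<open>E\<close> with probability \<open>\<theta>\<close>. If the set \<open>T\<close>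
    chosen for \<open>insert a E\<close> contains \<open>a\<close>, one factor
    \<open>\<theta>\<close> goes into the first summand of \<open>h\<close> and \<open>a\<close> is
    removed from \<open>T\<close>; if not, \<open>g \<le> h\<close> suffices.\<close>
  define h where "h E = \<theta> * g (insert a E) + (1 - \<theta>) * g E" for E
  have q0: "0 \<le> q e" if "e \<in> I" for e
  proof -
    have "0 \<le> \<theta> * p e" using insert.prems(1)[of e] that \<theta> by simp
    then show ?thesis using insert.prems(3)[of e] that by simp
  qed
  have g_le_h: "g E \<le> h E" for E
    using mult_left_mono[OF insert.prems(6)[of E "insert a E"] \<theta>(1)]
    by (auto simp: h_def algebra_simps)
  have "random_subset_expectation p I (\<lambda>E. f (insert a E)) \<le> random_subset_expectation q I h"
  proof (rule insert.IH)
    show "0 \<le> h E" for E using insert.prems(5) \<theta> by (simp add: h_def)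
    show "h E \<le> h F" if "E \<subseteq> F" for E F
      unfolding h_def using that \<theta>
      by (intro add_mono mult_left_mono insert.prems(6)) auto
    show "\<exists>T\<subseteq>E. f (insert a E) \<le> \<theta> ^ card T * h T" if E: "E \<subseteq> I" for E
    proof -
      obtain T where T: "T \<subseteq> insert a E" "f (insert a E) \<le> \<theta> ^ card T * g T"
        using insert.prems(7)[of "insert a E"] E by auto
      show ?thesis
      proof (cases "a \<in> T")
        case True
        have "finite T" using T E insert.hyps finite_subset by (metis finite_insert)
        then have "\<theta> ^ card T * g T = \<theta> ^ card (T - {a}) * (\<theta> * g (insert a (T - {a})))"
          using True card_Suc_Diff1[of T a] by (simp add: insert_absorb flip: power_Suc2)
        also have "\<dots> \<le> \<theta> ^ card (T - {a}) * h (T - {a})"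
          using \<theta> insert.prems(5) by (intro mult_left_mono) (auto simp: h_def)
        finally show ?thesis using T by (intro exI[of _ "T - {a}"]) auto
      next
        case False
        then show ?thesis
          using T \<theta> order_trans[OF T(2) mult_left_mono[OF g_le_h]] by (intro exI[of _ T]) auto
      qed
    qed
  qed (use insert.prems(1-6) in auto)
  also have "\<dots> = \<theta> * random_subset_expectation q I (\<lambda>E. g (insert a E))
      + (1 - \<theta>) * random_subset_expectation q I g"
    unfolding h_def by (rule random_subset_expectation_linear)
  finally have 1: "random_subset_expectation p I (\<lambda>E. f (insert a E)) \<le> \<dots>" .
  have 2: "random_subset_expectation p I f \<le> random_subset_expectation q I g"
  proof (rule insert.IH)
    show "\<exists>T\<subseteq>E. f E \<le> \<theta> ^ card T * g T" if "E \<subseteq> I" for E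
      using insert.prems(7)[of E] that by blast
  qed (use insert.prems(1-6) in auto)
  \<comment> \<open>Monotonicity of \<open>g\<close> makes the presence of \<open>a\<close>
    favourable, so its probability may be raised from \<open>\<theta> * p a\<close> to
    \<open>q a\<close>.\<close>
  have 3: "random_subset_expectation q I g \<le> random_subset_expectation q I (\<lambda>E. g (insert a E))"
  proof (rule random_subset_expectation_mono)
    show "g E \<le> g (insert a E)" for E by (rule insert.prems(6)) auto
  qed (use q0 insert.prems(4) in auto)
  have "p a * random_subset_expectation p I (\<lambda>E. f (insert a E)) + (1 - p a) * random_subset_expectation p I f
      \<le> p a * (\<theta> * random_subset_expectation q I (\<lambda>E. g (insert a E)) + (1 - \<theta>) * random_subset_expectation q I g)
        + (1 - p a) * random_subset_expectation q I g"
    using 1 2 insert.prems(1,2)[of a] by (intro add_mono mult_left_mono) auto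
  also have "\<dots> \<le> q a * random_subset_expectation q I (\<lambda>E. g (insert a E)) + (1 - q a) * random_subset_expectation q I g"
    using mult_left_mono[OF 3, of "q a - \<theta> * p a"] insert.prems(3)[of a]
    by (simp add: algebra_simps)
  finally show ?case
    using insert.hyps by (simp add: random_subset_expectation_insert)
qed

section \<open>Spanning trees and simple paths\<close>

definition connects :: "'v set set \<Rightarrow> 'v \<Rightarrow> 'v set \<Rightarrow> bool" where
  "connects E v K \<longleftrightarrow> (\<forall>x\<in>K. (v, x) \<in> {(x, y). {x, y} \<in> E}\<^sup>*)"

lemma connects_mono: "connects E v K \<Longrightarrow> E \<subseteq> F \<Longrightarrow> connects F v K"
  unfolding connects_def
  using rtrancl_mono[of "{(x, y). {x, y} \<in> E}" "{(x, y). {x, y} \<in> F}"] by blast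

text \<open>A breadth-first tree: every vertex other than \<open>v\<close> chooses a neighbour one
  step closer to \<open>v\<close> in the graph distance \<open>d\<close>. There is at most one edge
  per non-root vertex, and induction on \<open>d\<close> follows the parents back to
  \<open>v\<close>.\<close>

lemma connects_spanning_tree:
  assumes K: "finite K" "v \<in> K" and E: "\<Union>E \<subseteq> K" and con: "connects E v K"
  obtains T where "T \<subseteq> E" "card T \<le> card K - 1" "connects T v K"
proof -
  let ?R = "{(x, y). {x, y} \<in> E}"
  define d where "d x = (LEAST n. (v, x) \<in> ?R ^^ n)" for x
  have d: "(v, x) \<in> ?R ^^ d x" if "x \<in> K" for x
  proof -
    have "\<exists>n. (v, x) \<in> ?R ^^ n" using con that by (auto simp: connects_def dest: rtrancl_imp_relpow)
    then show ?thesis unfolding d_def by (rule LeastI_ex)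
  qed
  have "\<exists>y. {y, x} \<in> E \<and> d y < d x" if "x \<in> K - {v}" for x
  proof -
    have "d x \<noteq> 0" using d[of x] that by (metis DiffE insertI1 relpow_0_E)
    then obtain n where n: "d x = Suc n" using not0_implies_Suc by blast
    have "(v, x) \<in> ?R ^^ Suc n" using d[of x] that n by simp
    then obtain y where y: "(v, y) \<in> ?R ^^ n" "(y, x) \<in> ?R"
      by (rule relpow_Suc_E)
    then have "d y \<le> n" unfolding d_def by (intro Least_le)
    then show ?thesis using y n by auto
  qed
  then obtain par where par: "\<And>x. x \<in> K - {v} \<Longrightarrow> {par x, x} \<in> E \<and> d (par x) < d x"
    by metis
  define T where "T = (\<lambda>x. {par x, x}) ` (K - {v})"
  show thesis
  proof
    show "T \<subseteq> E" using par by (auto simp: T_def)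
    have "card T \<le> card (K - {v})" unfolding T_def using K by (intro card_image_le) auto
    then show "card T \<le> card K - 1" using K by simp
    have "(v, x) \<in> {(x, y). {x, y} \<in> T}\<^sup>*" if "x \<in> K" for x
      using that
    proof (induction "d x" arbitrary: x rule: less_induct)
      case less
      show ?case
      proof (cases "x = v")
        case False
        with less.prems have x: "x \<in> K - {v}" by simp
        have "par x \<in> K" using par[OF x] E by auto
        then have "(v, par x) \<in> {(x, y). {x, y} \<in> T}\<^sup>*" using less.hyps par[OF x] by blast
        moreover have "(par x, x) \<in> {(x, y). {x, y} \<in> T}" using x by (auto simp: T_def)
        ultimately show ?thesis by (rule rtrancl_into_rtrancl)
      qed simp
    qed
    then show "connects T v K" by (simp add: connects_def)
  qed
qed

primrec path_edges :: "'v \<Rightarrow> 'v list \<Rightarrow> 'v set set" where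
  "path_edges x [] = {}"
| "path_edges x (y # ys) = insert {x, y} (path_edges y ys)"

lemma finite_path_edges: "finite (path_edges x xs)"
  by (induction xs arbitrary: x) auto

lemma Union_path_edges: "\<Union>(path_edges x xs) \<subseteq> set (x # xs)"
  by (induction xs arbitrary: x) auto

lemma path_edges_suffix: "x # xs = us @ z # vs \<Longrightarrow> path_edges z vs \<subseteq> path_edges x xs"
proof (induction us arbitrary: x xs)
  case (Cons u us)
  show ?case
  proof (cases xs)
    case (Cons y ys)
    then have "path_edges z vs \<subseteq> path_edges y ys"
      using Cons.IH[of y ys] Cons.prems by simp
    then show ?thesis unfolding Cons by auto
  qed (use Cons.prems in simp)
qed simp

text \<open>Loop erasure, carried out from the front: when the new first vertex already lies on the
  path, everything before its occurrence is cut off.\<close>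

lemma rtrancl_simple_path:
  assumes "(x, h) \<in> {(x, y). x \<noteq> y \<and> {x, y} \<in> E \<and> x \<in> V \<and> y \<in> V}\<^sup>*"
  shows "\<exists>xs. distinct (x # xs) \<and> set xs \<subseteq> V \<and> path_edges x xs \<subseteq> E \<and> h = last (x # xs)"
  using assms
proof (induction rule: converse_rtrancl_induct)
  case base
  show ?case by (intro exI[of _ "[]"]) auto
next
  case (step z x)
  then obtain xs where xs: "distinct (x # xs)" "set xs \<subseteq> V" "path_edges x xs \<subseteq> E" "h = last (x # xs)"
    by blast
  show ?case
  proof (cases "z \<in> set (x # xs)")
    case True
    then obtain us vs where uv: "x # xs = us @ z # vs" by (meson split_list)
    have "distinct (z # vs)" using xs(1) unfolding uv by simp
    moreover have "set vs \<subseteq> V" using xs(2) uv by (cases us) auto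
    moreover have "last (z # vs) = h" using xs(4) unfolding uv by simp
    ultimately show ?thesis using path_edges_suffix[OF uv] xs(3) by (intro exI[of _ vs]) auto
  next
    case False
    then show ?thesis using xs step.hyps(1) by (intro exI[of _ "x # xs"]) auto
  qed
qed

section \<open>Poisson percolation on a group\<close>

text \<open>Concavity of 1 - exp(-x), which vanishes at 0. In terms of edges, lowering a Poisson
  mean by the factor \<open>\<theta>\<close> leaves at least the fraction \<open>\<theta>\<close> of
  the probability that the edge is present, as the thinning comparison requires.\<close>

lemma one_minus_exp_scale:
  fixes x \<theta> :: real
  assumes "0 \<le> \<theta>" "\<theta> \<le> 1"
  shows "\<theta> * (1 - exp (- x)) \<le> 1 - exp (- (\<theta> * x))"
  using convex_onD[OF exp_convex, of \<theta> 0 "- x"] assms by (simp add: algebra_simps)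

lemma pred_countable_Bex:
  assumes "countable X" "\<And>i. i \<in> X \<Longrightarrow> Measurable.pred M (P i)"
  shows "Measurable.pred M (\<lambda>x. \<exists>i\<in>X. P i x)"
proof -
  have "{x \<in> space M. \<exists>i\<in>X. P i x} = (\<Union>i\<in>X. {x \<in> space M. P i x})" by auto
  moreover have "\<dots> \<in> sets M" using assms by (intro sets.countable_UN'') (auto simp: pred_def)
  ultimately show ?thesis by (simp add: pred_def)
qed

lemma pred_countable_Ball:
  assumes "countable X" "\<And>i. i \<in> X \<Longrightarrow> Measurable.pred M (P i)"
  shows "Measurable.pred M (\<lambda>x. \<forall>i\<in>X. P i x)"
proof -
  have "Measurable.pred M (\<lambda>x. \<not> (\<exists>i\<in>X. \<not> P i x))"
    using assms by (intro pred_intros_logic pred_countable_Bex)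
  then show ?thesis by simp
qed

lemma borel_measurable_nn_integral_count_space:
  fixes f :: "'i \<Rightarrow> 'a \<Rightarrow> ennreal"
  assumes I: "countable I" and f [measurable]: "\<And>i. i \<in> I \<Longrightarrow> f i \<in> borel_measurable M"
  shows "(\<lambda>x. \<integral>\<^sup>+i. f i x \<partial>count_space I) \<in> borel_measurable M"
proof (cases "finite I")
  case True
  then show ?thesis by (simp add: nn_integral_count_space_finite)
next
  case False
  then have "from_nat_into I n \<in> I" for n by (intro from_nat_into) auto
  moreover have "(\<integral>\<^sup>+i. f i x \<partial>count_space I) = (\<Sum>n. f (from_nat_into I n) x)" for x
    using nn_integral_bij_count_space[OF bij_betw_from_nat_into[OF I False], of "\<lambda>i. f i x"]
    by (simp add: nn_integral_count_space_nat)
  ultimately show ?thesis by simp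
qed

context group
begin

text \<open>Countability makes the cluster events measurable in the product space and allows null
  sets to be collected over all vertices and all pairs.\<close>

lemma countable_carrier_generate:
  assumes S: "countable S" "S \<subseteq> carrier G" "generate G S = carrier G"
  shows "countable (carrier G)"
proof -
  define L where "L = lists (S \<union> m_inv G ` S)"
  let ?p = "\<lambda>xs. foldr (\<lambda>x y. x \<otimes> y) xs \<one>"
  have app: "set xs \<subseteq> carrier G \<Longrightarrow> set ys \<subseteq> carrier G \<Longrightarrow> ?p xs \<in> carrier G \<and> ?p (xs @ ys) = ?p xs \<otimes> ?p ys" for xs ys
  proof (induction xs)
    case Nil
    have "?p ys \<in> carrier G" using Nil(2) by (induction ys) auto
    then show ?case by simp
  next
    case (Cons x xs)
    have "?p ys \<in> carrier G" using Cons(3) by (induction ys) auto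
    then show ?case using Cons by (simp add: m_assoc)
  qed
  have sub: "set xs \<subseteq> carrier G" if "xs \<in> L" for xs
    using that S by (auto simp: L_def lists_eq_set)
  have "x \<in> ?p ` L" if "x \<in> generate G S" for x
    using that
  proof (induction rule: generate.induct)
    case one
    show ?case by (intro image_eqI[of _ _ "[]"]) (auto simp: L_def)
  next
    case (incl h)
    then show ?case using S by (intro image_eqI[of _ _ "[h]"]) (auto simp: L_def)
  next
    case (inv h)
    then show ?case using S by (intro image_eqI[of _ _ "[inv h]"]) (auto simp: L_def)
  next
    case (eng h1 h2)
    then obtain xs ys where "xs \<in> L" "ys \<in> L" "h1 = ?p xs" "h2 = ?p ys" by auto
    then show ?case using app[OF sub sub, of xs ys]
      by (intro image_eqI[of _ _ "xs @ ys"]) (auto simp: L_def)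
  qed
  then have "carrier G \<subseteq> ?p ` L" using S(3) by auto
  moreover have "countable (?p ` L)"
    using S(1) by (auto simp: L_def intro!: countable_image countable_lists)
  ultimately show ?thesis by (rule countable_subset)
qed

definition cluster :: "('a set \<Rightarrow> nat) \<Rightarrow> 'a \<Rightarrow> 'a set" where
  "cluster \<omega> v = {h. (v, h) \<in> (adjacent G \<omega>)\<^sup>*}"

lemma cluster_subset_carrier:
  assumes "v \<in> carrier G" shows "cluster \<omega> v \<subseteq> carrier G"
proof
  fix h assume "h \<in> cluster \<omega> v"
  then have "(v, h) \<in> (adjacent G \<omega>)\<^sup>*" by (simp add: cluster_def)
  then show "h \<in> carrier G" using assms by (induction rule: rtrancl_induct) (auto simp: adjacent_def)
qed

lemma has_infinite_component_iff:
  "has_infinite_component G \<omega> \<longleftrightarrow> (\<exists>v\<in>carrier G. infinite (cluster \<omega> v))"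
  by (simp add: has_infinite_component_def cluster_def)

text \<open>This is \<open>lam ^ length xs\<close> times the probability that the random walk with
  step law \<open>\<mu>\<close>, started at \<open>x\<close>, follows the list.\<close>

primrec path_weight :: "('a \<Rightarrow> real) \<Rightarrow> real \<Rightarrow> 'a \<Rightarrow> 'a list \<Rightarrow> real" where
  "path_weight \<mu> lam x [] = 1"
| "path_weight \<mu> lam x (y # ys) = lam * \<mu> (inv x \<otimes> y) * path_weight \<mu> lam y ys"

lemma path_edges_subset_pairs:
  "distinct (x # xs) \<Longrightarrow> set (x # xs) \<subseteq> carrier G \<Longrightarrow> path_edges x xs \<subseteq> pairs G"
  by (induction xs arbitrary: x) (auto simp: pairs_def)

section \<open>The law of the random multigraph and measurability of its clusters\<close>

context
  fixes \<mu> :: "'a \<Rightarrow> real"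
  assumes sym: "sym_prob G \<mu>" and cnt: "countable (carrier G)"
begin

lemma mu_nonneg: "g \<in> carrier G \<Longrightarrow> \<mu> g \<ge> 0"
  using sym unfolding sym_prob_def by blast

lemma pair_weight_eq:
  assumes gh: "g \<in> carrier G" "h \<in> carrier G" "g \<noteq> h"
  shows "pair_weight G \<mu> {g, h} = \<mu> (inv g \<otimes> h)"
proof -
  define a where "a = (SOME a. a \<in> {g, h})"
  define b where "b = (SOME b. b \<in> {g, h} \<and> b \<noteq> a)"
  have a: "a \<in> {g, h}" unfolding a_def by (rule someI[of _ g]) simp
  then have "\<exists>b. b \<in> {g, h} \<and> b \<noteq> a" using gh by auto
  then have b: "b \<in> {g, h} \<and> b \<noteq> a" unfolding b_def by (rule someI_ex)
  have "pair_weight G \<mu> {g, h} = \<mu> (inv a \<otimes> b)"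
    by (simp add: pair_weight_def a_def b_def Let_def)
  moreover have "\<mu> (inv h \<otimes> g) = \<mu> (inv g \<otimes> h)"
  proof -
    have "inv (inv g \<otimes> h) = inv h \<otimes> g" using gh by (simp add: inv_mult_group)
    moreover have "inv g \<otimes> h \<in> carrier G" using gh by simp
    ultimately show ?thesis using sym unfolding sym_prob_def by metis
  qed
  ultimately show ?thesis using a b by auto
qed

lemma pair_weight_nonneg: "e \<in> pairs G \<Longrightarrow> pair_weight G \<mu> e \<ge> 0"
  by (auto simp: pairs_def pair_weight_eq mu_nonneg)

lemma countable_pairs: "countable (pairs G)"
proof -
  have "pairs G \<subseteq> (\<lambda>(g, h). {g, h}) ` (carrier G \<times> carrier G)" by (auto simp: pairs_def)
  then show ?thesis by (rule countable_subset) (use cnt in auto)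
qed

lemma prob_space_multigraph_law: "prob_space (multigraph_law G \<mu> lam)"
  unfolding multigraph_law_def by (intro prob_space_PiM) (rule prob_space_measure_pmf)

lemma emeasure_multigraph_law:
  "emeasure (multigraph_law G \<mu> lam) A = ennreal (measure (multigraph_law G \<mu> lam) A)"
  by (rule finite_measure.emeasure_eq_measure[OF prob_space.finite_measure[OF prob_space_multigraph_law]])

lemma measurable_edge [measurable]:
  assumes "e \<in> pairs G"
  shows "(\<lambda>\<omega>. \<omega> e) \<in> measurable (multigraph_law G \<mu> lam) (count_space UNIV)"
proof -
  have "(\<lambda>\<omega>. \<omega> e) \<in> measurable (multigraph_law G \<mu> lam) (measure_pmf (poisson (lam * pair_weight G \<mu> e)))"
    unfolding multigraph_law_def using assms by (rule measurable_component_singleton)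
  then show ?thesis by simp
qed

lemma multigraph_law_box:
  assumes "finite A" "finite B" "A \<inter> B = {}" "A \<subseteq> pairs G" "B \<subseteq> pairs G" "lam \<ge> 0"
  shows "measure (multigraph_law G \<mu> lam)
     {\<omega> \<in> space (multigraph_law G \<mu> lam). (\<forall>e\<in>A. \<omega> e > 0) \<and> (\<forall>e\<in>B. \<omega> e = 0)} =
     (\<Prod>e\<in>A. 1 - exp (- (lam * pair_weight G \<mu> e))) * (\<Prod>e\<in>B. exp (- (lam * pair_weight G \<mu> e)))"
  unfolding multigraph_law_def
  by (rule poisson_product_box) (use assms pair_weight_nonneg in auto)

lemma pred_adjacent:
  "Measurable.pred (multigraph_law G \<mu> lam) (\<lambda>\<omega>. (y, h) \<in> adjacent G \<omega>)"
proof (cases "y \<in> carrier G \<and> h \<in> carrier G \<and> y \<noteq> h")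
  case True
  then have [measurable]: "(\<lambda>\<omega>. \<omega> {y, h}) \<in> measurable (multigraph_law G \<mu> lam) (count_space UNIV)"
    by (intro measurable_edge) (auto simp: pairs_def)
  have "Measurable.pred (multigraph_law G \<mu> lam) (\<lambda>\<omega>. \<omega> {y, h} > 0)" by measurable
  with True show ?thesis by (simp add: adjacent_def)
next
  case False
  then have "(\<lambda>\<omega>. (y, h) \<in> adjacent G \<omega>) = (\<lambda>_. False)" by (auto simp: adjacent_def)
  then show ?thesis by simp
qed

lemma pred_relpow_adjacent:
  "Measurable.pred (multigraph_law G \<mu> lam) (\<lambda>\<omega>. (v, h) \<in> adjacent G \<omega> ^^ n)"
proof (induction n arbitrary: h)
  case (Suc n)
  have "(v, h) \<in> adjacent G \<omega> ^^ Suc n \<longleftrightarrow>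
      (\<exists>y\<in>carrier G. (v, y) \<in> adjacent G \<omega> ^^ n \<and> (y, h) \<in> adjacent G \<omega>)" for \<omega>
    by (auto simp: adjacent_def)
  moreover have "Measurable.pred (multigraph_law G \<mu> lam)
      (\<lambda>\<omega>. \<exists>y\<in>carrier G. (v, y) \<in> adjacent G \<omega> ^^ n \<and> (y, h) \<in> adjacent G \<omega>)"
    by (intro pred_countable_Bex pred_intros_logic cnt Suc pred_adjacent)
  ultimately show ?case by simp
qed simp

lemma pred_mem_cluster:
  "Measurable.pred (multigraph_law G \<mu> lam) (\<lambda>\<omega>. h \<in> cluster \<omega> v)"
  unfolding cluster_def mem_Collect_eq rtrancl_power
  by (intro pred_intros_countable pred_relpow_adjacent)

lemma pred_cluster_eq:
  assumes v: "v \<in> carrier G" and K: "K \<subseteq> carrier G"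
  shows "Measurable.pred (multigraph_law G \<mu> lam) (\<lambda>\<omega>. cluster \<omega> v = K)"
proof -
  have "cluster \<omega> v = K \<longleftrightarrow> (\<forall>h\<in>carrier G. h \<in> cluster \<omega> v \<longleftrightarrow> h \<in> K)" for \<omega>
    using cluster_subset_carrier[OF v, of \<omega>] K by auto
  moreover have "Measurable.pred (multigraph_law G \<mu> lam)
      (\<lambda>\<omega>. \<forall>h\<in>carrier G. h \<in> cluster \<omega> v \<longleftrightarrow> h \<in> K)"
    using pred_mem_cluster[measurable] by (intro pred_countable_Ball cnt) measurable
  ultimately show ?thesis by simp
qed

text \<open>A countable set has only countably many finite subsets, so finiteness is a countable
  union of the events that the cluster is a given set.\<close>

lemma pred_finite_cluster:
  assumes v: "v \<in> carrier G"
  shows "Measurable.pred (multigraph_law G \<mu> lam) (\<lambda>\<omega>. finite (cluster \<omega> v))"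
proof -
  have "finite (cluster \<omega> v) \<longleftrightarrow> (\<exists>K\<in>{K. K \<subseteq> carrier G \<and> finite K}. cluster \<omega> v = K)" for \<omega>
    using cluster_subset_carrier[OF v, of \<omega>] by auto
  moreover have "Measurable.pred (multigraph_law G \<mu> lam)
      (\<lambda>\<omega>. \<exists>K\<in>{K. K \<subseteq> carrier G \<and> finite K}. cluster \<omega> v = K)"
    using v cnt countable_Collect_finite_subset[of "carrier G"]
    by (intro pred_countable_Bex pred_cluster_eq) (auto simp: conj_commute)
  ultimately show ?thesis by simp
qed

lemma pred_has_infinite_component:
  "Measurable.pred (multigraph_law G \<mu> lam) (has_infinite_component G)"
proof -
  have "Measurable.pred (multigraph_law G \<mu> lam) (\<lambda>\<omega>. \<exists>v\<in>carrier G. \<not> finite (cluster \<omega> v))"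
    by (intro pred_countable_Bex pred_intros_logic cnt pred_finite_cluster)
  moreover have "has_infinite_component G = (\<lambda>\<omega>. \<exists>v\<in>carrier G. \<not> finite (cluster \<omega> v))"
    by (rule ext) (rule has_infinite_component_iff)
  ultimately show ?thesis by simp
qed

text \<open>A product over a set counts every edge once; it agrees with the product along the list
  because a simple path repeats no edge.\<close>

lemma prod_path_edges:
  "distinct (x # xs) \<Longrightarrow> set (x # xs) \<subseteq> carrier G \<Longrightarrow>
     (\<Prod>e\<in>path_edges x xs. lam * pair_weight G \<mu> e) = path_weight \<mu> lam x xs"
proof (induction xs arbitrary: x)
  case (Cons y ys)
  have "{x, y} \<notin> path_edges y ys" using Union_path_edges[of y ys] Cons.prems(1) by auto
  then show ?case
    using Cons by (simp add: finite_path_edges pair_weight_eq)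
qed simp

lemma prob_open_path_le:
  assumes "lam \<ge> 0" "distinct (x # xs)" "set (x # xs) \<subseteq> carrier G"
  shows "measure (multigraph_law G \<mu> lam)
     {\<omega> \<in> space (multigraph_law G \<mu> lam). \<forall>e\<in>path_edges x xs. \<omega> e > 0} \<le> path_weight \<mu> lam x xs"
proof -
  note sub = path_edges_subset_pairs[OF assms(2,3)]
  have "measure (multigraph_law G \<mu> lam)
     {\<omega> \<in> space (multigraph_law G \<mu> lam). \<forall>e\<in>path_edges x xs. \<omega> e > 0} =
     (\<Prod>e\<in>path_edges x xs. 1 - exp (- (lam * pair_weight G \<mu> e)))"
    using multigraph_law_box[OF finite_path_edges finite.emptyI, of x xs lam] sub assms(1) by simp
  also have "\<dots> \<le> (\<Prod>e\<in>path_edges x xs. lam * pair_weight G \<mu> e)"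
  proof (intro prod_mono conjI)
    fix e assume "e \<in> path_edges x xs"
    then have "lam * pair_weight G \<mu> e \<ge> 0" using sub pair_weight_nonneg assms(1) by auto
    then show "0 \<le> 1 - exp (- (lam * pair_weight G \<mu> e))" by simp
    show "1 - exp (- (lam * pair_weight G \<mu> e)) \<le> lam * pair_weight G \<mu> e"
      using exp_ge_add_one_self[of "- (lam * pair_weight G \<mu> e)"] by linarith
  qed
  also have "\<dots> = path_weight \<mu> lam x xs" by (rule prod_path_edges[OF assms(2,3)])
  finally show ?thesis .
qed

section \<open>First moment bound: finite clusters below intensity 1\<close>

lemma bij_betw_left_mult: "g \<in> carrier G \<Longrightarrow> bij_betw (\<lambda>x. g \<otimes> x) (carrier G) (carrier G)"
  by (rule bij_betw_byWitness[of _ "\<lambda>x. inv g \<otimes> x"]) (auto simp: m_assoc[symmetric])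

lemma has_sum_mu_translate:
  "g \<in> carrier G \<Longrightarrow> ((\<lambda>h. \<mu> (inv g \<otimes> h)) has_sum 1) (carrier G)"
  using sym has_sum_reindex_bij_betw[OF bij_betw_left_mult[of "inv g"], of \<mu> 1]
  unfolding sym_prob_def by blast

lemma nn_integral_mu_translate:
  assumes g: "g \<in> carrier G"
  shows "(\<integral>\<^sup>+h. ennreal (\<mu> (inv g \<otimes> h)) \<partial>count_space (carrier G)) = 1"
proof -
  have nn: "\<mu> (inv g \<otimes> h) \<ge> 0" if "h \<in> carrier G" for h using g that by (intro mu_nonneg) auto
  have s: "(\<lambda>h. \<mu> (inv g \<otimes> h)) summable_on carrier G"
    using has_sum_mu_translate[OF g] by (rule has_sum_imp_summable)
  then have "(\<lambda>h. norm (\<mu> (inv g \<otimes> h))) summable_on carrier G"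
    using nn by (subst summable_on_cong[of _ _ "\<lambda>h. \<mu> (inv g \<otimes> h)"]) auto
  then have a: "Infinite_Set_Sum.abs_summable_on (\<lambda>h. \<mu> (inv g \<otimes> h)) (carrier G)"
    by (rule abs_summable_equivalent[THEN iffD1])
  show ?thesis
    using nn_integral_conv_infsetsum[OF a nn] infsetsum_infsum[OF a] infsumI[OF has_sum_mu_translate[OF g]]
    by simp
qed

definition lists_of_length :: "nat \<Rightarrow> 'a list set" where
  "lists_of_length n = {xs. set xs \<subseteq> carrier G \<and> length xs = n}"

text \<open>All lists are summed, self-avoiding or not, including those that stay at a vertex.
  Peeling off the first step then gives the full mass 1 of \<open>\<mu>\<close> and a factor
  \<open>lam\<close>, so the total is exact; it dominates the sum over simple paths.\<close>

lemma nn_integral_path_weight: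
  assumes lam: "lam \<ge> 0" and x: "x \<in> carrier G"
  shows "(\<integral>\<^sup>+xs. ennreal (path_weight \<mu> lam x xs) \<partial>count_space (lists_of_length n)) = ennreal (lam ^ n)"
  using x
proof (induction n arbitrary: x)
  case 0
  have "lists_of_length 0 = {[]}" by (auto simp: lists_of_length_def)
  then show ?case by (simp add: nn_integral_count_space_finite)
next
  case (Suc n)
  let ?L = "lists_of_length n"
  have bij: "bij_betw (\<lambda>(y, ys). y # ys) (carrier G \<times> ?L) (lists_of_length (Suc n))"
    by (rule bij_betw_byWitness[of _ "\<lambda>xs. (hd xs, tl xs)"])
       (auto simp: lists_of_length_def length_Suc_conv)
  have "(\<integral>\<^sup>+xs. ennreal (path_weight \<mu> lam x xs) \<partial>count_space (lists_of_length (Suc n)))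
      = (\<integral>\<^sup>+z. ennreal (path_weight \<mu> lam x (case z of (y, ys) \<Rightarrow> y # ys)) \<partial>count_space (carrier G \<times> ?L))"
    by (rule nn_integral_bij_count_space[OF bij, symmetric])
  also have "\<dots> = (\<integral>\<^sup>+z. ennreal (path_weight \<mu> lam x (case z of (y, ys) \<Rightarrow> y # ys))
      * indicator (carrier G \<times> ?L) z \<partial>count_space UNIV)"
    by (simp add: nn_integral_count_space_indicator)
  also have "\<dots> = (\<integral>\<^sup>+y. \<integral>\<^sup>+ys. ennreal (path_weight \<mu> lam x (y # ys))
      * indicator (carrier G \<times> ?L) (y, ys) \<partial>count_space UNIV \<partial>count_space UNIV)"
    by (subst nn_integral_fst_count_space[symmetric]) simp
  also have "\<dots> = (\<integral>\<^sup>+y. (\<integral>\<^sup>+ys. ennreal (path_weight \<mu> lam x (y # ys)) \<partial>count_space ?L)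
      * indicator (carrier G) y \<partial>count_space UNIV)"
    by (intro nn_integral_cong)
       (auto simp: nn_integral_count_space_indicator indicator_def intro!: nn_integral_cong)
  also have "\<dots> = (\<integral>\<^sup>+y. (\<integral>\<^sup>+ys. ennreal (path_weight \<mu> lam x (y # ys)) \<partial>count_space ?L) \<partial>count_space (carrier G))"
    by (simp add: nn_integral_count_space_indicator)
  also have "\<dots> = (\<integral>\<^sup>+y. ennreal (lam ^ Suc n) * ennreal (\<mu> (inv x \<otimes> y)) \<partial>count_space (carrier G))"
  proof (rule nn_integral_cong)
    fix y assume "y \<in> space (count_space (carrier G))"
    then have y: "y \<in> carrier G" by simp
    have nn: "lam * \<mu> (inv x \<otimes> y) \<ge> 0" using lam y Suc.prems by (intro mult_nonneg_nonneg mu_nonneg) auto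
    have "(\<integral>\<^sup>+ys. ennreal (path_weight \<mu> lam x (y # ys)) \<partial>count_space ?L)
        = (\<integral>\<^sup>+ys. ennreal (lam * \<mu> (inv x \<otimes> y)) * ennreal (path_weight \<mu> lam y ys) \<partial>count_space ?L)"
      using nn by (intro nn_integral_cong) (simp add: ennreal_mult')
    also have "\<dots> = ennreal (lam * \<mu> (inv x \<otimes> y)) * ennreal (lam ^ n)"
      by (simp add: nn_integral_cmult Suc.IH[OF y])
    also have "\<dots> = ennreal (lam ^ Suc n) * ennreal (\<mu> (inv x \<otimes> y))"
      using lam nn y Suc.prems mu_nonneg[of "inv x \<otimes> y"]
      by (simp add: ennreal_mult[symmetric] mult_ac)
    finally show "(\<integral>\<^sup>+ys. ennreal (path_weight \<mu> lam x (y # ys)) \<partial>count_space ?L)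
        = ennreal (lam ^ Suc n) * ennreal (\<mu> (inv x \<otimes> y))" .
  qed
  also have "\<dots> = ennreal (lam ^ Suc n)"
    by (simp add: nn_integral_cmult nn_integral_mu_translate[OF Suc.prems])
  finally show ?case .
qed

lemma nn_integral_path_weight_all:
  assumes lam: "0 \<le> lam" "lam < 1" and x: "x \<in> carrier G"
  shows "(\<integral>\<^sup>+xs. ennreal (path_weight \<mu> lam x xs) \<partial>count_space (lists (carrier G))) < \<infinity>"
proof -
  let ?f = "\<lambda>xs. ennreal (path_weight \<mu> lam x xs)"
  have "(\<integral>\<^sup>+xs. ?f xs \<partial>count_space (lists (carrier G)))
      = (\<integral>\<^sup>+xs. (\<Sum>n. ?f xs * indicator (lists_of_length n) xs) \<partial>count_space (lists (carrier G)))"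
  proof (rule nn_integral_cong)
    fix xs assume "xs \<in> space (count_space (lists (carrier G)))"
    then have "(\<Sum>n. ?f xs * indicator (lists_of_length n) xs) =
        (\<Sum>n\<in>{length xs}. ?f xs * indicator (lists_of_length n) xs)"
      by (intro suminf_finite) (auto simp: lists_of_length_def indicator_def)
    also have "\<dots> = ?f xs"
      using \<open>xs \<in> _\<close> by (auto simp: lists_of_length_def indicator_def in_lists_conv_set)
    finally show "?f xs = (\<Sum>n. ?f xs * indicator (lists_of_length n) xs)" by simp
  qed
  also have "\<dots> = (\<Sum>n. \<integral>\<^sup>+xs. ?f xs * indicator (lists_of_length n) xs \<partial>count_space (lists (carrier G)))"
    by (rule nn_integral_suminf) simp
  also have "\<dots> = (\<Sum>n. \<integral>\<^sup>+xs. ?f xs \<partial>count_space (lists_of_length n))"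
  proof (intro suminf_cong)
    fix n
    have "lists_of_length n \<subseteq> lists (carrier G)" by (auto simp: lists_of_length_def in_lists_conv_set)
    then show "(\<integral>\<^sup>+xs. ?f xs * indicator (lists_of_length n) xs \<partial>count_space (lists (carrier G)))
        = (\<integral>\<^sup>+xs. ?f xs \<partial>count_space (lists_of_length n))"
      by (simp add: nn_integral_count_space_indicator)
         (auto intro!: nn_integral_cong simp: indicator_def)
  qed
  also have "\<dots> = (\<Sum>n. ennreal (lam ^ n))"
    using nn_integral_path_weight[OF lam(1) x] by simp
  also have "\<dots> = ennreal (\<Sum>n. lam ^ n)"
    using lam by (intro suminf_ennreal2) (auto intro: summable_geometric)
  also have "\<dots> < \<infinity>" by simp
  finally show ?thesis .
qed

text \<open>The expected number of open simple paths from \<open>v\<close> is at most a convergent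
  geometric series, so almost surely there are finitely many. Every vertex of the cluster is the
  endpoint of one of them.\<close>

lemma AE_finite_cluster:
  assumes lam: "0 \<le> lam" "lam < 1" and v: "v \<in> carrier G"
  shows "AE \<omega> in multigraph_law G \<mu> lam. finite (cluster \<omega> v)"
proof -
  let ?M = "multigraph_law G \<mu> lam"
  define D where "D = {xs \<in> lists (carrier G). distinct (v # xs)}"
  define A where "A xs = {\<omega> \<in> space ?M. \<forall>e\<in>path_edges v xs. \<omega> e > 0}" for xs
  have D: "countable D"
    by (rule countable_subset[OF _ countable_lists[OF cnt]]) (auto simp: D_def)
  have Dset: "distinct (v # xs)" "set (v # xs) \<subseteq> carrier G" if "xs \<in> D" for xs
    using that v by (auto simp: D_def in_lists_conv_set)
  have A [measurable]: "A xs \<in> sets ?M" if "xs \<in> D" for xs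
  proof -
    have "Measurable.pred ?M (\<lambda>\<omega>. \<forall>e\<in>path_edges v xs. \<omega> e > 0)"
    proof (intro pred_intros_finite finite_path_edges)
      fix e assume "e \<in> path_edges v xs"
      then have [measurable]: "(\<lambda>\<omega>. \<omega> e) \<in> measurable ?M (count_space UNIV)"
        using path_edges_subset_pairs[OF Dset[OF that]] by (intro measurable_edge) auto
      show "Measurable.pred ?M (\<lambda>\<omega>. \<omega> e > 0)" by measurable
    qed
    then show ?thesis unfolding A_def by (simp add: pred_def)
  qed
  have int: "(\<integral>\<^sup>+\<omega>. \<integral>\<^sup>+xs. indicator (A xs) \<omega> \<partial>count_space D \<partial>?M)
      = (\<integral>\<^sup>+xs. \<integral>\<^sup>+\<omega>. indicator (A xs) \<omega> \<partial>?M \<partial>count_space D)"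
    using D A by (intro nn_integral_count_space_nn_integral) auto
  also have "\<dots> \<le> (\<integral>\<^sup>+xs. ennreal (path_weight \<mu> lam v xs) \<partial>count_space D)"
    using prob_open_path_le[OF lam(1) Dset] A
    by (intro nn_integral_mono) (auto simp: emeasure_multigraph_law A_def intro!: ennreal_leI)
  also have "\<dots> \<le> (\<integral>\<^sup>+xs. ennreal (path_weight \<mu> lam v xs) \<partial>count_space (lists (carrier G)))"
    by (simp add: nn_integral_count_space_indicator, intro nn_integral_mono)
       (auto simp: D_def indicator_def)
  also have "\<dots> < \<infinity>" by (rule nn_integral_path_weight_all[OF lam v])
  finally have lt: "(\<integral>\<^sup>+\<omega>. \<integral>\<^sup>+xs. indicator (A xs) \<omega> \<partial>count_space D \<partial>?M) \<noteq> \<infinity>" by simp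
  have meas: "(\<lambda>\<omega>. \<integral>\<^sup>+xs. indicator (A xs) \<omega> \<partial>count_space D) \<in> borel_measurable ?M"
    using D A by (intro borel_measurable_nn_integral_count_space) auto
  have "AE \<omega> in ?M. (\<integral>\<^sup>+xs. indicator (A xs) \<omega> \<partial>count_space D) \<noteq> \<infinity>"
    by (rule nn_integral_PInf_AE[OF meas lt])
  then show ?thesis
  proof (rule AE_mp, intro AE_I2 impI)
    fix \<omega> assume \<omega>: "\<omega> \<in> space ?M" and fin: "(\<integral>\<^sup>+xs. indicator (A xs) \<omega> \<partial>count_space D) \<noteq> \<infinity>"
    have "(\<integral>\<^sup>+xs. indicator (A xs) \<omega> \<partial>count_space D) = (\<integral>\<^sup>+xs. indicator {xs \<in> D. \<omega> \<in> A xs} xs \<partial>count_space D)"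
      by (intro nn_integral_cong) (auto simp: indicator_def)
    also have "\<dots> = emeasure (count_space D) {xs \<in> D. \<omega> \<in> A xs}"
      by (intro nn_integral_indicator) auto
    finally have finD: "finite {xs \<in> D. \<omega> \<in> A xs}"
      using fin emeasure_count_space[of "{xs \<in> D. \<omega> \<in> A xs}" D] by (auto split: if_splits)
    have "cluster \<omega> v \<subseteq> (\<lambda>xs. last (v # xs)) ` {xs \<in> D. \<omega> \<in> A xs}"
    proof
      fix h assume h: "h \<in> cluster \<omega> v"
      have adj: "adjacent G \<omega> =
          {(x, y). x \<noteq> y \<and> {x, y} \<in> {e. \<omega> e > 0} \<and> x \<in> carrier G \<and> y \<in> carrier G}"
        unfolding adjacent_def by blast
      have "\<exists>xs. distinct (v # xs) \<and> set xs \<subseteq> carrier G \<and> path_edges v xs \<subseteq> {e. \<omega> e > 0}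
          \<and> h = last (v # xs)"
        using h unfolding cluster_def adj mem_Collect_eq[of h] by (rule rtrancl_simple_path)
      then obtain xs where xs: "distinct (v # xs)" "set xs \<subseteq> carrier G"
          "path_edges v xs \<subseteq> {e. \<omega> e > 0}" "h = last (v # xs)" by blast
      have "xs \<in> D" using xs by (auto simp: D_def in_lists_conv_set)
      moreover have "\<omega> \<in> A xs" using xs \<omega> by (auto simp: A_def)
      ultimately show "h \<in> (\<lambda>xs. last (v # xs)) ` {xs \<in> D. \<omega> \<in> A xs}"
        unfolding xs(4) by blast
    qed
    then show "finite (cluster \<omega> v)" using finD by (rule finite_subset[OF _ finite_imageI])
  qed
qed

lemma prob_infinite_component_subcritical:
  assumes lam: "0 \<le> lam" "lam < 1"
  shows "prob_infinite_component G \<mu> lam = 0"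
proof -
  let ?M = "multigraph_law G \<mu> lam"
  have "AE \<omega> in ?M. \<forall>v\<in>carrier G. finite (cluster \<omega> v)"
    using AE_finite_cluster[OF lam] cnt by (simp add: AE_ball_countable)
  then have "AE \<omega> in ?M. \<not> has_infinite_component G \<omega>"
    by (simp add: has_infinite_component_iff)
  then show ?thesis
    unfolding prob_infinite_component_def
    using pred_has_infinite_component by (subst prob_space.prob_Collect_eq_0[OF prob_space_multigraph_law]) (auto simp: pred_def)
qed

lemma lambda_c_ge_one: "lambda_c G \<mu> \<ge> 1"
proof (rule ereal_le_epsilon2)
  fix e :: real assume e: "0 < e"
  \<comment> \<open>The supremum defining \<open>lambda_c\<close> ranges over positive intensities;
    the maximum with 1/2 keeps \<open>lam\<close> positive when \<open>e\<close> is large.\<close>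
  define lam where "lam = max (1 / 2) (1 - e)"
  have lam: "0 < lam" "lam < 1" "1 \<le> lam + e" using e by (auto simp: lam_def)
  have "ereal lam \<le> lambda_c G \<mu>"
    unfolding lambda_c_def
    using lam prob_infinite_component_subcritical[of lam] by (intro Sup_upper) auto
  then have "ereal lam + ereal e \<le> lambda_c G \<mu> + ereal e" by (rule add_right_mono)
  moreover have "1 \<le> ereal lam + ereal e" using lam(3) by simp
  ultimately show "1 \<le> lambda_c G \<mu> + ereal e" by (rule order_trans[rotated])
qed

section \<open>The event that a finite set is the cluster\<close>

definition inner_pairs :: "'a set \<Rightarrow> 'a set set" where
  "inner_pairs K = {{x, y} | x y. x \<in> K \<and> y \<in> K \<and> x \<noteq> y}"

text \<open>Only boundary pairs of nonzero weight are listed. For finite \<open>K\<close> and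
  finitely supported \<open>\<mu>\<close> the set is therefore finite, even though infinitely many
  pairs may leave \<open>K\<close>.\<close>

definition outer_pairs :: "'a set \<Rightarrow> 'a set set" where
  "outer_pairs K = (\<lambda>(x, y). {x, y}) ` (SIGMA x:K. {y \<in> carrier G - K. \<mu> (inv x \<otimes> y) \<noteq> 0})"

text \<open>A version of \<open>cluster \<omega> v = K\<close> that looks at finitely many edges
  when \<open>K\<close> and the support of \<open>\<mu>\<close> are finite. The two can differ only
  if some pair of weight zero carries an edge, which has probability 0.\<close>

definition cluster_event :: "'a \<Rightarrow> 'a set \<Rightarrow> ('a set \<Rightarrow> nat) \<Rightarrow> bool" where
  "cluster_event v K \<omega> \<longleftrightarrow>
     connects {e \<in> inner_pairs K. \<omega> e > 0} v K \<and> (\<forall>e\<in>outer_pairs K. \<omega> e = 0)"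

lemma AE_weight_zero:
  assumes lam: "lam \<ge> 0"
  shows "AE \<omega> in multigraph_law G \<mu> lam. \<forall>e\<in>pairs G. pair_weight G \<mu> e = 0 \<longrightarrow> \<omega> e = 0"
proof (rule AE_ball_countable'[OF _ countable_pairs])
  fix e assume e: "e \<in> pairs G"
  show "AE \<omega> in multigraph_law G \<mu> lam. pair_weight G \<mu> e = 0 \<longrightarrow> \<omega> e = 0"
  proof (cases "pair_weight G \<mu> e = 0")
    case True
    have [measurable]: "(\<lambda>\<omega>. \<omega> e) \<in> measurable (multigraph_law G \<mu> lam) (count_space UNIV)"
      using e by (rule measurable_edge)
    have "{\<omega> \<in> space (multigraph_law G \<mu> lam). \<omega> e = 0} \<in> sets (multigraph_law G \<mu> lam)"
      by measurable
    moreover have "measure (multigraph_law G \<mu> lam) {\<omega> \<in> space (multigraph_law G \<mu> lam). \<omega> e = 0} = 1"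
      using multigraph_law_box[of "{}" "{e}" lam] e lam True by simp
    ultimately have "AE \<omega> in multigraph_law G \<mu> lam. \<omega> e = 0"
      by (subst prob_space.prob_Collect_eq_1[OF prob_space_multigraph_law, symmetric])
    then show ?thesis by simp
  qed simp
qed

lemma cluster_event_iff:
  assumes v: "v \<in> K" and K: "K \<subseteq> carrier G"
    and zero: "\<forall>e\<in>pairs G. pair_weight G \<mu> e = 0 \<longrightarrow> \<omega> e = 0"
  shows "cluster_event v K \<omega> \<longleftrightarrow> cluster \<omega> v = K"
proof -
  let ?R = "{(x, y). {x, y} \<in> {e \<in> inner_pairs K. \<omega> e > 0}}"
  have inner: "{x, y} \<in> inner_pairs K \<longleftrightarrow> x \<in> K \<and> y \<in> K \<and> x \<noteq> y" for x y
    by (auto simp: inner_pairs_def doubleton_eq_iff)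
  have "cluster \<omega> v = K" if ev: "cluster_event v K \<omega>"
  proof -
    have "?R \<subseteq> adjacent G \<omega>" using K by (auto simp: inner adjacent_def)
    then have "?R\<^sup>* \<subseteq> (adjacent G \<omega>)\<^sup>*" by (rule rtrancl_mono)
    then have "K \<subseteq> cluster \<omega> v"
      using ev by (auto simp: cluster_event_def connects_def cluster_def)
    moreover have "h \<in> K" if "(v, h) \<in> (adjacent G \<omega>)\<^sup>*" for h
      using that
    proof (induction rule: rtrancl_induct)
      case (step y z)
      show ?case
      proof (rule ccontr)
        assume z: "z \<notin> K"
        have yz: "y \<in> carrier G" "z \<in> carrier G" "y \<noteq> z" "\<omega> {y, z} > 0"
          using step.hyps by (auto simp: adjacent_def)
        then have p: "{y, z} \<in> pairs G" by (auto simp: pairs_def)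
        then have "\<mu> (inv y \<otimes> z) \<noteq> 0"
          using zero yz pair_weight_eq[of y z] by force
        then have "{y, z} \<in> outer_pairs K"
          using yz z step.IH unfolding outer_pairs_def by (intro image_eqI[of _ _ "(y, z)"]) auto
        then show False using ev yz by (auto simp: cluster_event_def)
      qed
    qed (rule v)
    ultimately show ?thesis by (auto simp: cluster_def)
  qed
  moreover have "cluster_event v K \<omega>" if cl: "cluster \<omega> v = K"
  proof -
    have "(v, h) \<in> ?R\<^sup>*" if "(v, h) \<in> (adjacent G \<omega>)\<^sup>*" for h
      using that
    proof (induction rule: rtrancl_induct)
      case (step y z)
      have "(v, z) \<in> (adjacent G \<omega>)\<^sup>*" using step.hyps by (rule rtrancl_into_rtrancl)
      then have "y \<in> K" "z \<in> K" using step.hyps cl by (auto simp: cluster_def)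
      then have "(y, z) \<in> ?R" using step.hyps(2) by (auto simp: inner adjacent_def)
      with step.IH show ?case by (rule rtrancl_into_rtrancl)
    qed simp
    then have "connects {e \<in> inner_pairs K. \<omega> e > 0} v K"
      using cl unfolding connects_def cluster_def by blast
    moreover have "\<omega> e = 0" if e: "e \<in> outer_pairs K" for e
    proof (rule ccontr)
      assume "\<omega> e \<noteq> 0"
      obtain x y where xy: "e = {x, y}" "x \<in> K" "y \<in> carrier G" "y \<notin> K"
        using e by (auto simp: outer_pairs_def)
      have "(x, y) \<in> adjacent G \<omega>"
        using xy K \<open>\<omega> e \<noteq> 0\<close> by (auto simp: adjacent_def)
      moreover have "(v, x) \<in> (adjacent G \<omega>)\<^sup>*" using xy cl by (auto simp: cluster_def)
      ultimately have "y \<in> cluster \<omega> v" unfolding cluster_def by (auto intro: rtrancl_into_rtrancl)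
      then show False using cl xy by simp
    qed
    ultimately show ?thesis by (simp add: cluster_event_def)
  qed
  ultimately show ?thesis by blast
qed

context
  assumes fin: "finite {x \<in> carrier G. \<mu> x \<noteq> 0}"
begin

lemma finite_neighbours:
  assumes x: "x \<in> carrier G"
  shows "finite {y \<in> carrier G. \<mu> (inv x \<otimes> y) \<noteq> 0}"
  using fsupp_left_translate[of \<mu> "inv x"] fin x by (simp add: fsupp_def)

text \<open>A boundary pair has exactly one endpoint in \<open>K\<close>, so the unordered pairs can
  be summed as ordered ones starting in \<open>K\<close>. The weights issuing from each vertex add
  up to 1, and what does not leave \<open>K\<close> is the internal sum, diagonal terms
  included.\<close>

lemma sum_outer_pairs:
  assumes K: "finite K" "K \<subseteq> carrier G"
  shows "(\<Sum>e\<in>outer_pairs K. pair_weight G \<mu> e) =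
           real (card K) - (\<Sum>g\<in>K. \<Sum>h\<in>K. \<mu> (inv g \<otimes> h))"
proof -
  let ?N = "\<lambda>x. {y \<in> carrier G - K. \<mu> (inv x \<otimes> y) \<noteq> 0}"
  have finN: "finite (?N x)" if "x \<in> K" for x
    by (rule finite_subset[OF _ finite_neighbours[of x]]) (use that K in auto)
  have "inj_on (\<lambda>(x, y). {x, y}) (Sigma K ?N)"
    by (auto simp: inj_on_def doubleton_eq_iff)
  then have "(\<Sum>e\<in>outer_pairs K. pair_weight G \<mu> e) = (\<Sum>(x, y)\<in>Sigma K ?N. pair_weight G \<mu> {x, y})"
    unfolding outer_pairs_def by (simp add: sum.reindex case_prod_unfold)
  also have "\<dots> = (\<Sum>(x, y)\<in>Sigma K ?N. \<mu> (inv x \<otimes> y))"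
    using K by (intro sum.cong) (auto intro!: pair_weight_eq)
  also have "\<dots> = (\<Sum>x\<in>K. \<Sum>y\<in>?N x. \<mu> (inv x \<otimes> y))"
    using K finN by (intro sum.Sigma[symmetric]) auto
  also have "\<dots> = (\<Sum>x\<in>K. 1 - (\<Sum>y\<in>K. \<mu> (inv x \<otimes> y)))"
  proof (rule sum.cong)
    fix x assume x: "x \<in> K"
    have "((\<lambda>y. \<mu> (inv x \<otimes> y)) has_sum (\<Sum>y\<in>K \<union> ?N x. \<mu> (inv x \<otimes> y))) (carrier G)"
      using finN[OF x] K by (intro has_sum_finite_neutralI[of "K \<union> ?N x"]) auto
    moreover have "((\<lambda>y. \<mu> (inv x \<otimes> y)) has_sum 1) (carrier G)"
      using x K by (intro has_sum_mu_translate) auto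
    ultimately have "(\<Sum>y\<in>K \<union> ?N x. \<mu> (inv x \<otimes> y)) = 1" by (rule has_sum_unique)
    moreover have "(\<Sum>y\<in>K \<union> ?N x. \<mu> (inv x \<otimes> y)) = (\<Sum>y\<in>K. \<mu> (inv x \<otimes> y)) + (\<Sum>y\<in>?N x. \<mu> (inv x \<otimes> y))"
      using finN[OF x] K by (intro sum.union_disjoint) auto
    ultimately show "(\<Sum>y\<in>?N x. \<mu> (inv x \<otimes> y)) = 1 - (\<Sum>y\<in>K. \<mu> (inv x \<otimes> y))" by linarith
  qed simp
  also have "\<dots> = real (card K) - (\<Sum>g\<in>K. \<Sum>h\<in>K. \<mu> (inv g \<otimes> h))"
    by (simp add: sum_subtractf)
  finally show ?thesis .
qed

lemma finite_inner_pairs: "finite K \<Longrightarrow> finite (inner_pairs K)"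
  unfolding inner_pairs_def by (rule finite_subset[of _ "Pow K"]) auto

lemma finite_outer_pairs: "finite K \<Longrightarrow> K \<subseteq> carrier G \<Longrightarrow> finite (outer_pairs K)"
  unfolding outer_pairs_def
proof (intro finite_imageI finite_SigmaI)
  fix x assume "K \<subseteq> carrier G" "x \<in> K"
  then have "finite {y \<in> carrier G. \<mu> (inv x \<otimes> y) \<noteq> 0}" by (intro finite_neighbours) auto
  then show "finite {y \<in> carrier G - K. \<mu> (inv x \<otimes> y) \<noteq> 0}" by (rule finite_subset[rotated]) auto
qed

lemma inner_pairs_subset: "K \<subseteq> carrier G \<Longrightarrow> inner_pairs K \<subseteq> pairs G"
  by (auto simp: inner_pairs_def pairs_def)

lemma outer_pairs_subset: "K \<subseteq> carrier G \<Longrightarrow> outer_pairs K \<subseteq> pairs G"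
  by (auto simp: outer_pairs_def pairs_def)

lemma inner_outer_disjoint: "inner_pairs K \<inter> outer_pairs K = {}"
  by (auto simp: inner_pairs_def outer_pairs_def doubleton_eq_iff)

text \<open>The event splits into disjoint boxes according to the exact set of inner pairs that
  carry an edge. Each box fixes finitely many independent coordinates, and the condition on the
  outer pairs is a common factor.\<close>

lemma cluster_event_measure:
  assumes K: "finite K" "K \<subseteq> carrier G" and lam: "lam \<ge> 0"
  shows "{\<omega> \<in> space (multigraph_law G \<mu> lam). cluster_event v K \<omega>} \<in> sets (multigraph_law G \<mu> lam)"
    and "measure (multigraph_law G \<mu> lam) {\<omega> \<in> space (multigraph_law G \<mu> lam). cluster_event v K \<omega>} =
      random_subset_expectation (\<lambda>e. 1 - exp (- (lam * pair_weight G \<mu> e))) (inner_pairs K)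
        (\<lambda>E. of_bool (connects E v K))
      * exp (- (lam * (\<Sum>e\<in>outer_pairs K. pair_weight G \<mu> e)))"
proof -
  let ?M = "multigraph_law G \<mu> lam" and ?I = "inner_pairs K" and ?O = "outer_pairs K"
  define C where "C = {E \<in> Pow ?I. connects E v K}"
  define box where "box E = {\<omega> \<in> space ?M. (\<forall>e\<in>E. \<omega> e > 0) \<and> (\<forall>e\<in>(?I - E) \<union> ?O. \<omega> e = 0)}" for E
  note IO = finite_inner_pairs[OF K(1)] finite_outer_pairs[OF K] inner_pairs_subset[OF K(2)]
    outer_pairs_subset[OF K(2)] inner_outer_disjoint[of K]
  have C: "finite C" using IO(1) by (simp add: C_def)
  have E: "finite E" "E \<subseteq> ?I" "E \<inter> (?I - E \<union> ?O) = {}" if "E \<in> C" for E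
    using that IO finite_subset[of E ?I] by (auto simp: C_def)
  have box_meas: "box E \<in> sets ?M" if "E \<in> C" for E
  proof -
    have edge: "Measurable.pred ?M (\<lambda>\<omega>. \<omega> e > 0)" "Measurable.pred ?M (\<lambda>\<omega>. \<omega> e = 0)"
      if "e \<in> ?I \<union> ?O" for e
    proof -
      have [measurable]: "(\<lambda>\<omega>. \<omega> e) \<in> measurable ?M (count_space UNIV)"
        using that IO by (intro measurable_edge) auto
      show "Measurable.pred ?M (\<lambda>\<omega>. \<omega> e > 0)" "Measurable.pred ?M (\<lambda>\<omega>. \<omega> e = 0)"
        by measurable
    qed
    have "Measurable.pred ?M (\<lambda>\<omega>. \<forall>e\<in>E. \<omega> e > 0)"
      using E[OF that] edge by (intro pred_intros_finite) auto
    moreover have "Measurable.pred ?M (\<lambda>\<omega>. \<forall>e\<in>(?I - E) \<union> ?O. \<omega> e = 0)"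
      using IO(1,2) edge by (intro pred_intros_finite) auto
    ultimately have "Measurable.pred ?M (\<lambda>\<omega>. (\<forall>e\<in>E. \<omega> e > 0) \<and> (\<forall>e\<in>(?I - E) \<union> ?O. \<omega> e = 0))"
      by (intro pred_intros_logic)
    then show ?thesis unfolding box_def by (simp add: pred_def)
  qed
  have open_eq: "{e \<in> ?I. \<omega> e > 0} = E" if "E \<in> C" "\<omega> \<in> box E" for \<omega> E
  proof (intro equalityI subsetI)
    fix e assume e: "e \<in> {e \<in> ?I. \<omega> e > 0}"
    show "e \<in> E"
    proof (rule ccontr)
      assume "e \<notin> E"
      then have "\<omega> e = 0" using e that(2) by (simp add: box_def)
      with e show False by simp
    qed
  qed (use that in \<open>auto simp: C_def box_def\<close>)
  have eq: "{\<omega> \<in> space ?M. cluster_event v K \<omega>} = (\<Union>E\<in>C. box E)"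
  proof (intro equalityI subsetI)
    fix \<omega> assume "\<omega> \<in> {\<omega> \<in> space ?M. cluster_event v K \<omega>}"
    then show "\<omega> \<in> (\<Union>E\<in>C. box E)"
      by (intro UN_I[of "{e \<in> ?I. \<omega> e > 0}"]) (auto simp: C_def box_def cluster_event_def)
  next
    fix \<omega> assume "\<omega> \<in> (\<Union>E\<in>C. box E)"
    then obtain E where E: "E \<in> C" "\<omega> \<in> box E" by auto
    then have "{e \<in> ?I. \<omega> e > 0} = E" by (rule open_eq)
    with E show "\<omega> \<in> {\<omega> \<in> space ?M. cluster_event v K \<omega>}"
      by (auto simp: C_def box_def cluster_event_def)
  qed
  show "{\<omega> \<in> space ?M. cluster_event v K \<omega>} \<in> sets ?M"
    unfolding eq using C box_meas by (intro sets.finite_UN) auto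
  have disj: "disjoint_family_on box C"
    unfolding disjoint_family_on_def
  proof (intro ballI impI)
    fix E F assume EF: "E \<in> C" "F \<in> C" "E \<noteq> F"
    then show "box E \<inter> box F = {}" using open_eq by blast
  qed
  have "measure ?M (\<Union>E\<in>C. box E) = (\<Sum>E\<in>C. measure ?M (box E))"
    using C box_meas disj prob_space.finite_measure[OF prob_space_multigraph_law]
    by (intro finite_measure.finite_measure_finite_Union) auto
  \<comment> \<open>The shape \<open>1 - (1 - exp ...)\<close> is that of the factor
    \<open>1 - p e\<close> in \<open>random_subset_expectation\<close>.\<close>
  also have "\<dots> = (\<Sum>E\<in>C. (\<Prod>e\<in>E. 1 - exp (- (lam * pair_weight G \<mu> e)))
      * (\<Prod>e\<in>?I - E. 1 - (1 - exp (- (lam * pair_weight G \<mu> e))))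
      * exp (- (lam * (\<Sum>e\<in>?O. pair_weight G \<mu> e))))"
  proof (rule sum.cong)
    fix F assume F: "F \<in> C"
    have "measure ?M (box F) = (\<Prod>e\<in>F. 1 - exp (- (lam * pair_weight G \<mu> e))) *
        (\<Prod>e\<in>?I - F \<union> ?O. exp (- (lam * pair_weight G \<mu> e)))"
      unfolding box_def using E[OF F] IO lam by (intro multigraph_law_box) auto
    also have "(\<Prod>e\<in>?I - F \<union> ?O. exp (- (lam * pair_weight G \<mu> e))) =
        (\<Prod>e\<in>?I - F. exp (- (lam * pair_weight G \<mu> e))) * (\<Prod>e\<in>?O. exp (- (lam * pair_weight G \<mu> e)))"
      using IO by (intro prod.union_disjoint) auto
    also have "(\<Prod>e\<in>?O. exp (- (lam * pair_weight G \<mu> e))) = exp (- (lam * (\<Sum>e\<in>?O. pair_weight G \<mu> e)))"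
      using IO by (simp add: exp_sum[symmetric] sum_negf sum_distrib_left)
    finally show "measure ?M (box F) = (\<Prod>e\<in>F. 1 - exp (- (lam * pair_weight G \<mu> e)))
      * (\<Prod>e\<in>?I - F. 1 - (1 - exp (- (lam * pair_weight G \<mu> e))))
      * exp (- (lam * (\<Sum>e\<in>?O. pair_weight G \<mu> e)))"
      by (simp add: mult.assoc)
  qed simp
  also have "\<dots> = (\<Sum>E\<in>C. (\<Prod>e\<in>E. 1 - exp (- (lam * pair_weight G \<mu> e)))
      * (\<Prod>e\<in>?I - E. 1 - (1 - exp (- (lam * pair_weight G \<mu> e)))))
      * exp (- (lam * (\<Sum>e\<in>?O. pair_weight G \<mu> e)))"
    by (rule sum_distrib_right[symmetric])
  also have "(\<Sum>E\<in>C. (\<Prod>e\<in>E. 1 - exp (- (lam * pair_weight G \<mu> e)))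
      * (\<Prod>e\<in>?I - E. 1 - (1 - exp (- (lam * pair_weight G \<mu> e))))) =
      random_subset_expectation (\<lambda>e. 1 - exp (- (lam * pair_weight G \<mu> e))) ?I
        (\<lambda>E. of_bool (connects E v K))"
    unfolding random_subset_expectation_def
    using IO(1) by (intro sum.mono_neutral_cong_left) (auto simp: C_def)
  finally show "measure ?M {\<omega> \<in> space ?M. cluster_event v K \<omega>} =
      random_subset_expectation (\<lambda>e. 1 - exp (- (lam * pair_weight G \<mu> e))) ?I
        (\<lambda>E. of_bool (connects E v K))
      * exp (- (lam * (\<Sum>e\<in>?O. pair_weight G \<mu> e)))"
    unfolding eq .
qed

text \<open>Lowering the intensity from \<open>lam\<close> to \<open>\<theta> lam\<close> costs a factor \<open>\<theta>\<close> per spanning tree edge,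
  but gains \<open>exp ((1 - \<theta>) lam)\<close> per unit of boundary weight; the choice
  \<open>\<theta> = 1 / (lam (1 - \<epsilon>))\<close> makes the gain outweigh the cost by a factor \<open>1 / \<theta>\<close>.\<close>

lemma prob_cluster_eq_le:
  assumes K: "finite K" "K \<subseteq> carrier G" "v \<in> K"
    and sparse: "(\<Sum>g\<in>K. \<Sum>h\<in>K. \<mu> (inv g \<otimes> h)) \<le> \<epsilon> * real (card K)"
    and lam: "lam > 0" "lam * (1 - \<epsilon>) > 1"
  defines "\<theta> \<equiv> 1 / (lam * (1 - \<epsilon>))"
  shows "measure (multigraph_law G \<mu> lam) {\<omega> \<in> space (multigraph_law G \<mu> lam). cluster \<omega> v = K} \<le>
    \<theta> * measure (multigraph_law G \<mu> (\<theta> * lam))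
      {\<omega> \<in> space (multigraph_law G \<mu> (\<theta> * lam)). cluster \<omega> v = K}"
proof -
  define a where "a = lam * (1 - \<epsilon>)"
  define b where "b = (\<Sum>e\<in>outer_pairs K. pair_weight G \<mu> e)"
  define R where "R l = random_subset_expectation (\<lambda>e. 1 - exp (- (l * pair_weight G \<mu> e)))
      (inner_pairs K) (\<lambda>E. of_bool (connects E v K))" for l
  have \<theta>: "0 < \<theta>" "\<theta> \<le> 1" "\<theta> * a = 1" using lam(2) by (simp_all add: \<theta>_def flip: a_def)
  define k where "k = card K"
  have k: "k > 0" using K by (auto simp: k_def card_gt_0_iff)
  have w: "pair_weight G \<mu> e \<ge> 0" if "e \<in> inner_pairs K" for e
    using that inner_pairs_subset[OF K(2)] by (intro pair_weight_nonneg) auto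
  have eq: "measure (multigraph_law G \<mu> l) {\<omega> \<in> space (multigraph_law G \<mu> l). cluster \<omega> v = K}
      = R l * exp (- (l * b))" if l: "l \<ge> 0" for l
  proof -
    have "measure (multigraph_law G \<mu> l) {\<omega> \<in> space (multigraph_law G \<mu> l). cluster \<omega> v = K} =
        measure (multigraph_law G \<mu> l) {\<omega> \<in> space (multigraph_law G \<mu> l). cluster_event v K \<omega>}"
    proof (rule measure_eq_AE)
      show "AE \<omega> in multigraph_law G \<mu> l. \<omega> \<in> {\<omega> \<in> space (multigraph_law G \<mu> l). cluster \<omega> v = K} \<longleftrightarrow>
          \<omega> \<in> {\<omega> \<in> space (multigraph_law G \<mu> l). cluster_event v K \<omega>}"
        by (rule AE_mp[OF AE_weight_zero[OF l]]) (intro AE_I2 impI, simp add: cluster_event_iff[OF K(3,2)])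
      show "{\<omega> \<in> space (multigraph_law G \<mu> l). cluster \<omega> v = K} \<in> sets (multigraph_law G \<mu> l)"
        using pred_cluster_eq[of v K l] K by (auto simp: pred_def)
    qed (rule cluster_event_measure(1)[OF K(1,2) l])
    then show ?thesis using cluster_event_measure(2)[OF K(1,2) l] by (simp add: R_def b_def)
  qed
  \<comment> \<open>In the thinning comparison the set to be kept is a spanning tree of
    \<open>K\<close>: it has at most \<open>k - 1\<close> edges, each costing a factor
    \<open>\<theta>\<close>, and keeping it preserves connectedness.\<close>
  have "\<theta> ^ (k - 1) * R lam \<le> R (\<theta> * lam)"
  proof -
    have "\<theta> ^ (k - 1) * R lam = random_subset_expectation (\<lambda>e. 1 - exp (- (lam * pair_weight G \<mu> e)))
        (inner_pairs K) (\<lambda>E. \<theta> ^ (k - 1) * of_bool (connects E v K))"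
      using random_subset_expectation_linear[of _ _ "\<theta> ^ (k - 1)" "\<lambda>E. of_bool (connects E v K)" 0 "\<lambda>_. 0"]
      by (simp add: R_def)
    also have "\<dots> \<le> R (\<theta> * lam)"
      unfolding R_def
    proof (rule random_subset_expectation_thinning[where \<theta> = \<theta>])
      fix E assume E: "E \<subseteq> inner_pairs K"
      show "\<exists>T\<subseteq>E. \<theta> ^ (k - 1) * of_bool (connects E v K) \<le> \<theta> ^ card T * of_bool (connects T v K)"
      proof (cases "connects E v K")
        case True
        have "\<Union>E \<subseteq> K" using E by (auto simp: inner_pairs_def)
        then obtain T where "T \<subseteq> E" "card T \<le> card K - 1" "connects T v K"
          using connects_spanning_tree[OF K(1,3) _ True] by blast
        then show ?thesis
          using \<theta> by (intro exI[of _ T]) (auto simp: k_def intro!: power_decreasing)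
      qed auto
    next
      fix e assume e: "e \<in> inner_pairs K"
      show "\<theta> * (1 - exp (- (lam * pair_weight G \<mu> e))) \<le> 1 - exp (- (\<theta> * lam * pair_weight G \<mu> e))"
        using one_minus_exp_scale[of \<theta> "lam * pair_weight G \<mu> e"] \<theta> by (simp add: mult.assoc)
      show "0 \<le> 1 - exp (- (lam * pair_weight G \<mu> e))" using w[OF e] lam by simp
    qed (use \<theta> finite_inner_pairs[OF K(1)] in \<open>auto intro: connects_mono\<close>)
    finally show ?thesis .
  qed
  \<comment> \<open>The boundary weight \<open>b\<close> is at least
    \<open>(1 - \<epsilon>) * real k\<close>, so the gain is at least
    \<open>exp ((1 - \<theta>) * a)\<close> per vertex. As \<open>\<theta> * a = 1\<close>, the
    exponent is \<open>a - 1\<close> and the gain is at least \<open>a\<close>. This gives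
    \<open>k\<close> factors against \<open>k - 1\<close> tree edges, which leaves the factor
    \<open>\<theta>\<close> of the claim.\<close>
  moreover have "exp (- (lam * b)) \<le> \<theta> ^ k * exp (- (\<theta> * lam * b))"
  proof -
    have "b \<ge> (1 - \<epsilon>) * real k"
      using sum_outer_pairs[OF K(1,2)] sparse by (simp add: b_def k_def algebra_simps)
    then have "lam * b \<ge> a * real k"
      using lam mult_left_mono[of "(1 - \<epsilon>) * real k" b lam] by (simp add: a_def algebra_simps)
    then have le: "(1 - \<theta>) * (a * real k) \<le> (1 - \<theta>) * (lam * b)"
      using \<theta> by (intro mult_left_mono) auto
    have "a \<le> exp (a - 1)" using exp_ge_add_one_self[of "a - 1"] by simp
    also have "a - 1 = (1 - \<theta>) * a" using \<theta> by (simp add: algebra_simps)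
    finally have "a ^ k \<le> exp ((1 - \<theta>) * a) ^ k"
      using lam by (intro power_mono) (auto simp: a_def)
    also have "\<dots> = exp ((1 - \<theta>) * (a * real k))"
      by (simp add: exp_of_nat_mult[symmetric] mult_ac)
    also have "\<dots> \<le> exp ((1 - \<theta>) * (lam * b))" using le by simp
    finally have "\<theta> ^ k * a ^ k \<le> \<theta> ^ k * exp ((1 - \<theta>) * (lam * b))"
      using \<theta> by (intro mult_left_mono) auto
    then have "1 \<le> \<theta> ^ k * exp ((1 - \<theta>) * (lam * b))"
      using \<theta> by (simp add: power_mult_distrib[symmetric])
    then have "exp (- (lam * b)) * 1 \<le> exp (- (lam * b)) * (\<theta> ^ k * exp ((1 - \<theta>) * (lam * b)))"
      by (intro mult_left_mono) auto
    also have "\<dots> = \<theta> ^ k * (exp (- (lam * b)) * exp ((1 - \<theta>) * (lam * b)))"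
      by (simp add: mult_ac)
    also have "exp (- (lam * b)) * exp ((1 - \<theta>) * (lam * b)) = exp (- (\<theta> * lam * b))"
      by (simp add: exp_add[symmetric] algebra_simps)
    finally show ?thesis by simp
  qed
  moreover have "R lam \<ge> 0"
    unfolding R_def random_subset_expectation_def
    using w lam by (intro sum_nonneg mult_nonneg_nonneg prod_nonneg) auto
  ultimately have "R lam * exp (- (lam * b)) \<le> R lam * (\<theta> ^ k * exp (- (\<theta> * lam * b)))"
    by (intro mult_left_mono)
  also have "\<dots> = \<theta> * (\<theta> ^ (k - 1) * R lam) * exp (- (\<theta> * lam * b))"
    using k by (simp add: power_eq_if)
  also have "\<dots> \<le> \<theta> * R (\<theta> * lam) * exp (- (\<theta> * lam * b))"
    using \<open>\<theta> ^ (k - 1) * R lam \<le> R (\<theta> * lam)\<close> \<theta> by (intro mult_right_mono mult_left_mono) auto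
  finally show ?thesis using eq[of lam] eq[of "\<theta> * lam"] lam \<theta> by (simp add: mult.assoc)
qed

lemma prob_infinite_component_supercritical:
  assumes sparse: "\<And>K. finite K \<Longrightarrow> K \<subseteq> carrier G \<Longrightarrow>
      (\<Sum>g\<in>K. \<Sum>h\<in>K. \<mu> (inv g \<otimes> h)) \<le> \<epsilon> * real (card K)"
    and lam: "lam > 0" "lam * (1 - \<epsilon>) > 1"
  shows "prob_infinite_component G \<mu> lam > 0"
proof -
  define \<theta> where "\<theta> = 1 / (lam * (1 - \<epsilon>))"
  have \<theta>: "0 < \<theta>" "\<theta> < 1" using lam(2) by (simp_all add: \<theta>_def)
  let ?M = "\<lambda>l. multigraph_law G \<mu> l"
  define \<K> where "\<K> = {K. K \<subseteq> carrier G \<and> finite K \<and> \<one> \<in> K}"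
  have \<K>: "countable \<K>"
    by (rule countable_subset[OF _ countable_Collect_finite_subset[OF cnt]]) (auto simp: \<K>_def)
  define C where "C l K = {\<omega> \<in> space (?M l). cluster \<omega> \<one> = K}" for l K
  have C: "C l K \<in> sets (?M l)" if "K \<in> \<K>" for l K
    using pred_cluster_eq[of \<one> K l] that by (auto simp: C_def \<K>_def pred_def)
  have disj: "disjoint_family_on (C l) \<K>" for l
    by (auto simp: disjoint_family_on_def C_def)
  have "emeasure (?M lam) (\<Union>K\<in>\<K>. C lam K) = (\<integral>\<^sup>+K. emeasure (?M lam) (C lam K) \<partial>count_space \<K>)"
    by (intro emeasure_UN_countable C \<K> disj)
  also have "\<dots> \<le> (\<integral>\<^sup>+K. ennreal \<theta> * emeasure (?M (\<theta> * lam)) (C (\<theta> * lam) K) \<partial>count_space \<K>)"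
  proof (rule nn_integral_mono)
    fix K assume "K \<in> space (count_space \<K>)"
    then have K: "finite K" "K \<subseteq> carrier G" "\<one> \<in> K" by (auto simp: \<K>_def)
    have "measure (?M lam) (C lam K) \<le> \<theta> * measure (?M (\<theta> * lam)) (C (\<theta> * lam) K)"
      unfolding C_def \<theta>_def using prob_cluster_eq_le[OF K sparse[OF K(1,2)] lam] .
    then show "emeasure (?M lam) (C lam K) \<le> ennreal \<theta> * emeasure (?M (\<theta> * lam)) (C (\<theta> * lam) K)"
      using \<theta> by (simp add: emeasure_multigraph_law ennreal_mult[symmetric] ennreal_leI)
  qed
  also have "\<dots> = ennreal \<theta> * (\<integral>\<^sup>+K. emeasure (?M (\<theta> * lam)) (C (\<theta> * lam) K) \<partial>count_space \<K>)"
    by (rule nn_integral_cmult) simp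
  \<comment> \<open>At the lower intensity the events for different \<open>K\<close> are again
    disjoint, so their total is the probability of one event and at most 1.\<close>
  also have "(\<integral>\<^sup>+K. emeasure (?M (\<theta> * lam)) (C (\<theta> * lam) K) \<partial>count_space \<K>)
      = emeasure (?M (\<theta> * lam)) (\<Union>K\<in>\<K>. C (\<theta> * lam) K)"
    by (intro emeasure_UN_countable[symmetric] C \<K> disj)
  also have "ennreal \<theta> * \<dots> \<le> ennreal \<theta> * 1"
    by (intro mult_left_mono prob_space.measure_le_1[OF prob_space_multigraph_law]) simp
  finally have le: "measure (?M lam) (\<Union>K\<in>\<K>. C lam K) \<le> \<theta>"
    using \<theta> by (simp add: emeasure_multigraph_law)
  have "(\<Union>K\<in>\<K>. C lam K) = {\<omega> \<in> space (?M lam). finite (cluster \<omega> \<one>)}"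
    using cluster_subset_carrier[OF one_closed] by (auto simp: C_def \<K>_def cluster_def)
  then have "measure (?M lam) {\<omega> \<in> space (?M lam). finite (cluster \<omega> \<one>)} < 1"
    using le \<theta> by simp
  moreover have "{\<omega> \<in> space (?M lam). finite (cluster \<omega> \<one>)} \<in> sets (?M lam)"
    using pred_finite_cluster[OF one_closed, of lam] by (simp add: pred_def)
  ultimately have "measure (?M lam) {\<omega> \<in> space (?M lam). \<not> finite (cluster \<omega> \<one>)} > 0"
    by (simp add: prob_space.prob_neg[OF prob_space_multigraph_law])
  also have "measure (?M lam) {\<omega> \<in> space (?M lam). \<not> finite (cluster \<omega> \<one>)}
      \<le> prob_infinite_component G \<mu> lam"
    unfolding prob_infinite_component_def
    using pred_has_infinite_component[of lam] prob_space.finite_measure[OF prob_space_multigraph_law]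
    by (intro finite_measure.finite_measure_mono) (auto simp: pred_def has_infinite_component_iff)
  finally show ?thesis .
qed

lemma lambda_c_le:
  assumes sparse: "\<And>K. finite K \<Longrightarrow> K \<subseteq> carrier G \<Longrightarrow>
      (\<Sum>g\<in>K. \<Sum>h\<in>K. \<mu> (inv g \<otimes> h)) \<le> \<epsilon> * real (card K)"
    and eps: "\<epsilon> < 1"
  shows "lambda_c G \<mu> \<le> ereal (1 / (1 - \<epsilon>))"
  unfolding lambda_c_def
proof (rule Sup_least, clarify)
  fix lam :: real assume lam: "0 < lam" "prob_infinite_component G \<mu> lam = 0"
  have "\<not> lam * (1 - \<epsilon>) > 1"
    using prob_infinite_component_supercritical[OF sparse lam(1)] lam(2) by force
  then show "ereal lam \<le> ereal (1 / (1 - \<epsilon>))"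
    using eps by (simp add: field_simps)
qed

end

end

end

theorem theorem6:
  fixes G :: "('a, 'b) monoid_scheme" and S :: "'a set"
  assumes "group G"
    and "finite S" and "S \<subseteq> carrier G" and "generate G S = carrier G"
    and "\<not> amenable G"
  shows "epdim G S = 1"
proof -
  interpret group G by fact
  have cnt: "countable (carrier G)"
    using assms by (intro countable_carrier_generate[of S] countable_finite)
  obtain \<rho> :: real and \<mu> :: "nat \<Rightarrow> 'a \<Rightarrow> real" where \<rho>: "0 < \<rho>" "\<rho> < 1"
    and sym: "\<And>n. sym_prob G (\<mu> n)" and fin: "\<And>n. finite {x \<in> carrier G. \<mu> n x \<noteq> 0}"
    and small: "\<And>n x. x \<in> carrier G \<Longrightarrow> \<mu> n x \<le> \<rho> ^ n"
    and supp: "\<And>n x. x \<in> carrier G \<Longrightarrow> \<mu> n x \<noteq> 0 \<Longrightarrow> word_length G S x \<le> n"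
    and sparse: "\<And>n K. finite K \<Longrightarrow> K \<subseteq> carrier G \<Longrightarrow>
       (\<Sum>g\<in>K. \<Sum>h\<in>K. \<mu> n (inv\<^bsub>G\<^esub> g \<otimes>\<^bsub>G\<^esub> h)) \<le> \<rho> ^ n * real (card K)"
    using nonamenable_spread_measures[OF assms(2-5)] by blast
  \<comment> \<open>\<open>exp_class\<close> asks for a strict inequality, whereas the walk only
    satisfies the weak bound with base \<open>\<rho>\<close>; any base strictly between
    \<open>\<rho>\<close> and 1 would do.\<close>
  define r where "r = (1 + \<rho>) / 2"
  have r: "\<rho> < r" "0 < r" "r < 1" using \<rho> by (auto simp: r_def)
  have in_class: "\<mu> n \<in> exp_class G S r 1" if n: "n \<ge> 1" for n
  proof -
    have "\<mu> n x < r powr (real (word_length G S x) powr 1)" if x: "x \<in> carrier G" for x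
    proof -
      let ?k = "word_length G S x"
      have "\<mu> n x < r ^ ?k"
      proof (cases "\<mu> n x = 0")
        case True
        then show ?thesis using r by simp
      next
        case False
        show ?thesis
        \<comment> \<open>At word length 0 both powers are 1 and a larger base gains nothing;
          strictness comes from \<open>\<rho> ^ n < 1\<close>, hence the restriction to
          \<open>n \<ge> 1\<close>.\<close>
        proof (cases "?k = 0")
          case True
          have "\<rho> ^ n < 1" using \<rho> n by (simp add: power_less_one_iff)
          with True show ?thesis using small[OF x, of n] by simp
        next
          case k: False
          have "\<mu> n x \<le> \<rho> ^ n" by (rule small[OF x])
          also have "\<dots> \<le> \<rho> ^ ?k" using \<rho> supp[OF x False] by (intro power_decreasing) auto
          also have "\<dots> < r ^ ?k" using \<rho> r k by (intro power_strict_mono) auto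
          finally show ?thesis .
        qed
      qed
      then show ?thesis using r by (simp add: powr_realpow)
    qed
    then show ?thesis using sym by (simp add: exp_class_def)
  qed
  have "(INF \<nu>\<in>exp_class G S r 1. lambda_c G \<nu>) = 1"
  proof (rule antisym)
    show "1 \<le> (INF \<nu>\<in>exp_class G S r 1. lambda_c G \<nu>)"
      by (intro INF_greatest lambda_c_ge_one cnt) (auto simp: exp_class_def)
    have lim: "(\<lambda>n. ereal (1 / (1 - \<rho> ^ n))) \<longlonglongrightarrow> ereal (1 / (1 - 0))"
      using \<rho> by (intro tendsto_intros LIMSEQ_realpow_zero) auto
    have bound: "(INF \<nu>\<in>exp_class G S r 1. lambda_c G \<nu>) \<le> ereal (1 / (1 - \<rho> ^ n))"
      if n: "n \<ge> 1" for n
    proof -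
      have "\<rho> ^ n < 1" using \<rho> n by (simp add: power_less_one_iff)
      then have "lambda_c G (\<mu> n) \<le> ereal (1 / (1 - \<rho> ^ n))"
        by (intro lambda_c_le sym cnt fin sparse)
      then show ?thesis using in_class[OF n] by (rule INF_lower2[rotated])
    qed
    have "(INF \<nu>\<in>exp_class G S r 1. lambda_c G \<nu>) \<le> ereal (1 / (1 - 0))"
      by (rule LIMSEQ_le_const[OF lim], intro exI[of _ 1] allI impI, rule bound)
    then show "(INF \<nu>\<in>exp_class G S r 1. lambda_c G \<nu>) \<le> 1" by (simp add: one_ereal_def)
  qed
  then have "ereal 1 \<le> epdim G S"
    unfolding epdim_def using r by (intro Sup_upper) auto
  moreover have "epdim G S \<le> 1"
    unfolding epdim_def by (rule Sup_least) auto
  ultimately show ?thesis by (simp add: one_ereal_def)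
qed

end
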